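(* Let $0<\alpha<1$, $T>0$, and for $\tau=T/N$ ($N\in\mathbb{N}$) let $f^{(\tau)}(t):=\sum_{j=1}^N f_j\chi_{(t_{j-1},t_j]}(t)$, with initial value $f_0$. Provided $f^{(\tau)}$ is strongly convergent in $L^1(0,T)$ to a function $f$ as $\tau\to0$, for any smooth function $\phi\in C^1([0,T])$ we have $$\int_0^TD^\alpha_\tau f^{(\tau)}(t)\,\phi(t)\,dt\ \to\ -\int_0^Tf(t)\,{}^*D^\alpha_t\phi(t)\,dt+\frac{\phi(T)}{\Gamma_{1-\alpha}}\int_0^T\frac{f(t)}{(T-t)^\alpha}\,dt-\frac{f_0}{\Gamma_{1-\alpha}}\int_0^T\frac{\phi(s)}{s^\alpha}\,ds$$ as $\tau\to0$. Moreover, if the function $f$ is smooth enough, it holds $$\int_0^TD^\alpha_\tau f^{(\tau)}(t)\,\phi(t)\,dt\ \to\ \int_0^TD^\alpha_tf(t)\,\phi(t)\,dt\qquad\text{as }\tau\to0.$$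
   Context: $t_k=k\tau$, $\chi_A$ is the characteristic function of $A$, $\Gamma_z$ is the Gamma function at $z$. The values $f_1,\dots,f_N$ may depend on $\tau$; $f_0$ is fixed. The left and right Caputo derivatives are $$D_t^\alpha f(t)=\frac{1}{\Gamma_{1-\alpha}}\int_0^t\frac{f'(s)}{(t-s)^\alpha}\,ds,\qquad {}^*D_t^\alpha f(t)=\frac{1}{\Gamma_{1-\alpha}}\int_t^T\frac{f'(s)}{(s-t)^\alpha}\,ds.$$ The sequence $\{\lambda_k\}_{k\ge1}$ is defined by $\lambda_1=1$ and $\lambda_{k+1}=\sum_{j=1}^k\big((k-j+1)^{\alpha-1}-(k-j+2)^{\alpha-1}\big)\lambda_j$ for $k\ge1$. The discrete Caputo derivative is $(D^\alpha_\tau f)_k=\Gamma_\alpha\tau^{-\alpha}\sum_{j=0}^{k-1}\lambda_{k-j}(f_{j+1}-f_j)$, $1\le k\le N$, and $D^\alpha_\tau f^{(\tau)}(t)=(D^\alpha_\tau f)_k$ for $t\in(t_{k-1},t_k]$.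
   Formalization: When φ(T)≠0, convergence is also required in L¹(0,T) with weight (T−t)^{-α}; the second claim also assumes f(0)=f_0. Both are needed: f_N=τ^{α−1} (all other values 0) and f_k=1 with f_0=0 refute the claims otherwise. "Smooth enough" means f continuous on [0,T], differentiable inside, f' in L¹. *)

theory Defs
  imports "HOL-Analysis.Analysis"
begin

(* The index starts at 1; the value at 0 is a dummy. *)
fun caputo_weight :: "real \<Rightarrow> nat \<Rightarrow> real" where
  "caputo_weight \<alpha> 0 = 0"
| "caputo_weight \<alpha> (Suc k) =
     (if k = 0 then 1
      else (\<Sum>j=1..k. ((real k - real j + 1) powr (\<alpha> - 1) - (real k - real j + 2) powr (\<alpha> - 1))
                     * caputo_weight \<alpha> j))"

definition discrete_caputo :: "real \<Rightarrow> real \<Rightarrow> (nat \<Rightarrow> real) \<Rightarrow> nat \<Rightarrow> real" where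
  "discrete_caputo \<alpha> \<tau> v k =
     Gamma \<alpha> * \<tau> powr (- \<alpha>) * (\<Sum>j<k. caputo_weight \<alpha> (k - j) * (v (j + 1) - v j))"

(* Takes the value v k on the cell (t_(k-1), t_k], for k = 1, ..., N and t_k = k * tau;
   v 0 is not used. *)
definition step_interp :: "real \<Rightarrow> nat \<Rightarrow> (nat \<Rightarrow> real) \<Rightarrow> real \<Rightarrow> real" where
  "step_interp \<tau> N v t = (\<Sum>j=1..N. v j * indicator {(real j - 1) * \<tau> <.. real j * \<tau>} t)"

definition step_caputo :: "real \<Rightarrow> real \<Rightarrow> nat \<Rightarrow> (nat \<Rightarrow> real) \<Rightarrow> real \<Rightarrow> real" where
  "step_caputo \<alpha> \<tau> N v = step_interp \<tau> N (discrete_caputo \<alpha> \<tau> v)"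

(* The integrals are over open intervals, so deriv is never evaluated at an endpoint of [0,T],
   where it would depend on the values of f outside [0,T]. *)
definition left_caputo :: "real \<Rightarrow> (real \<Rightarrow> real) \<Rightarrow> real \<Rightarrow> real" where
  "left_caputo \<alpha> f t =
     1 / Gamma (1 - \<alpha>) * (LINT s:{0<..<t}|lebesgue. deriv f s / (t - s) powr \<alpha>)"

(* No minus sign in front: this is the convention under which integration by parts
   produces minus the integral of f against the right derivative. *)
definition right_caputo :: "real \<Rightarrow> real \<Rightarrow> (real \<Rightarrow> real) \<Rightarrow> real \<Rightarrow> real" where
  "right_caputo \<alpha> T f t =
     1 / Gamma (1 - \<alpha>) * (LINT s:{t<..<T}|lebesgue. deriv f s / (s - t) powr \<alpha>)"

(* C^1([a,b]) with one-sided derivatives at a and b; C1_differentiable_on would require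
   two-sided ones. *)
definition C1_on_Icc :: "real \<Rightarrow> real \<Rightarrow> (real \<Rightarrow> real) \<Rightarrow> bool" where
  "C1_on_Icc a b \<phi> \<longleftrightarrow>
     (\<exists>D. continuous_on {a..b} D \<and>
          (\<forall>t\<in>{a..b}. (\<phi> has_real_derivative D t) (at t within {a..b})))"

(* Differentiable in the interior, with f' in L^1(a,b), and continuous up to the endpoints.
   Every C^1([a,b]) function qualifies, as do functions such as t powr alpha on [0,T], whose
   derivative is unbounded at 0. *)
definition caputo_smooth_on :: "real \<Rightarrow> real \<Rightarrow> (real \<Rightarrow> real) \<Rightarrow> bool" where
  "caputo_smooth_on a b f \<longleftrightarrow>
     continuous_on {a..b} f \<and>
     (\<forall>t\<in>{a<..<b}. f differentiable (at t)) \<and>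
     set_integrable lebesgue {a<..<b} (deriv f)"

(* Convergence in the weighted space L^1((a,b); w(t) dt); w = 1 is strong L^1 convergence.
   The weight 1 / (T - t) powr alpha is needed for test functions with phi(T) nonzero: plain L^1
   convergence to f neither makes f(t) / (T - t)^alpha integrable nor excludes f_N = tau^(alpha-1),
   f_k = 0 for k < N, which tends to 0 in L^1 while the integral of its discrete Caputo
   derivative against phi tends to Gamma(alpha) * phi(T). *)
definition weighted_L1_tendsto ::
  "real \<Rightarrow> real \<Rightarrow> (real \<Rightarrow> real) \<Rightarrow> (nat \<Rightarrow> real \<Rightarrow> real) \<Rightarrow> (real \<Rightarrow> real) \<Rightarrow> bool" where
  "weighted_L1_tendsto a b w g f \<longleftrightarrow>
     set_integrable lebesgue {a<..<b} (\<lambda>t. f t * w t) \<and>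
     (\<forall>\<^sub>F N in sequentially. set_integrable lebesgue {a<..<b} (\<lambda>t. g N t * w t)) \<and>
     (\<lambda>N. LINT t:{a<..<b}|lebesgue. \<bar>g N t - f t\<bar> * w t) \<longlonglongrightarrow> 0"

end

theory Submission
  imports Defs "HOL-Real_Asymp.Real_Asymp"
begin

text \<open>
  The weights satisfy a resolvent equation: convolved with the kernel \<open>m powr (\<alpha> - 1)\<close> they give
  the constant sequence 1. The kernel is decreasing and log-convex, so the weights are
  nonnegative and decreasing, and \<open>caputo_weight \<alpha> k \<le> k powr (- \<alpha>)\<close>. Comparing the kernel
  with the binomial series of \<open>(1 - X)\<close> to the power \<open>- \<alpha>\<close> gives the growth of the partial sums
  of the weights, and the monotone density theorem turns this into
  \<open>caputo_weight \<alpha> k * k powr \<alpha> \<longlonglongrightarrow> 1 / (Gamma \<alpha> * Gamma (1 - \<alpha>))\<close> (lemma \<open>caputo_weight_asymp\<close>).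
  Hence \<open>Gamma \<alpha> * \<tau> powr (- \<alpha>) * caputo_weight \<alpha> k\<close> converges to the Caputo kernel
  \<open>s powr (- \<alpha>) / Gamma (1 - \<alpha>)\<close> as \<open>k * \<tau>\<close> tends to \<open>s\<close>, and is dominated by a multiple of it.

  The discrete derivative of the step function is paired with \<open>\<phi>\<close> cell by cell, and a double
  summation by parts (lemma \<open>discrete_caputo_summation_by_parts\<close>) moves the differences to the cell
  integrals of \<open>\<phi>\<close>. Three terms remain. Sums of the weights against difference quotients
  of the cell integrals are Riemann sums of the right Caputo derivative of \<open>\<phi>\<close> and converge
  boundedly and pointwise to it (lemma \<open>discrete_abel_tendsto\<close>), so \<open>L\<^sup>1\<close> convergence of the step
  functions allows the passage to the limit. The initial value meets a Riemann sum of the integral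
  of \<open>\<phi> s / s powr \<alpha>\<close>. The last cell leaves the average of \<open>\<phi>\<close> next to \<open>T\<close> times the
  weights read backwards from \<open>T\<close>, which is where convergence in the weighted space enters; for
  \<open>\<phi> T = 0\<close> the factor \<open>\<tau>\<close> gained from that average compensates for the singularity.

  For smooth \<open>f\<close> with the right initial value, the limit is rewritten by the integration by parts
  formula for fractional derivatives (lemma \<open>caputo_integration_by_parts\<close>), which follows from
  Fubini's theorem on triangles.
\<close>

section \<open>Power series of negative binomial type\<close>

unbundle no vec_syntax and fps_syntax

text \<open>
  The expansion of \<open>(1 - X)\<close> raised to the power \<open>- \<beta>\<close>.
\<close>

definition neg_binomial_fps :: "real \<Rightarrow> real fps" where
  "neg_binomial_fps \<beta> = Abs_fps (\<lambda>n. pochhammer \<beta> n / fact n)"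

lemma neg_binomial_fps_add:
  "neg_binomial_fps (\<beta> + \<gamma>) = neg_binomial_fps \<beta> * neg_binomial_fps \<gamma>"
proof (rule fps_ext)
  fix n
  have "pochhammer (\<beta> + \<gamma>) n / fact n
      = (\<Sum>k\<le>n. of_nat (n choose k) * pochhammer \<beta> k * pochhammer \<gamma> (n - k) / fact n)"
    by (simp add: pochhammer_binomial_sum sum_divide_distrib)
  also have "\<dots> = (\<Sum>k\<le>n. pochhammer \<beta> k / fact k * (pochhammer \<gamma> (n - k) / fact (n - k)))"
    by (intro sum.cong refl) (simp add: binomial_fact field_simps)
  finally show "neg_binomial_fps (\<beta> + \<gamma>) $ n = (neg_binomial_fps \<beta> * neg_binomial_fps \<gamma>) $ n"
    by (simp add: neg_binomial_fps_def fps_mult_nth atMost_atLeast0)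
qed

lemma neg_binomial_fps_1: "neg_binomial_fps 1 = Abs_fps (\<lambda>_. 1)"
  by (simp add: neg_binomial_fps_def pochhammer_fact[symmetric])

lemma neg_binomial_fps_nonneg: "\<beta> > 0 \<Longrightarrow> neg_binomial_fps \<beta> $ n \<ge> 0"
  by (simp add: neg_binomial_fps_def pochhammer_nonneg)

text \<open>
  The coefficients are, up to the factor \<open>n / (\<beta> + n)\<close> and the power \<open>n powr (\<beta> - 1)\<close>, the
  partial products of Euler's formula for the reciprocal of the Gamma function.
\<close>

lemma neg_binomial_fps_asymp:
  assumes "\<beta> > 0"
  shows "(\<lambda>n. neg_binomial_fps \<beta> $ n / real n powr (\<beta> - 1)) \<longlonglongrightarrow> 1 / Gamma \<beta>"
proof -
  have "(\<lambda>n. real n / (\<beta> + real n)) \<longlonglongrightarrow> 1" by real_asymp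
  from tendsto_mult[OF rGamma_series_LIMSEQ[of \<beta>] this]
  have "(\<lambda>n. rGamma_series \<beta> n * (real n / (\<beta> + real n))) \<longlonglongrightarrow> 1 / Gamma \<beta>"
    by (simp add: Gamma_def inverse_eq_divide)
  moreover have "\<forall>\<^sub>F n in sequentially.
      rGamma_series \<beta> n * (real n / (\<beta> + real n)) = neg_binomial_fps \<beta> $ n / real n powr (\<beta> - 1)"
    using eventually_gt_at_top[of 0]
  proof eventually_elim
    case (elim n)
    have "exp (\<beta> * ln (real n)) = real n powr (\<beta> - 1) * real n"
      using elim by (simp add: powr_def left_diff_distrib exp_diff)
    moreover have "\<beta> + real n > 0" using assms by simp
    ultimately show ?case using elim
      by (simp add: rGamma_series_def neg_binomial_fps_def pochhammer_Suc divide_simps)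
  qed
  ultimately show ?thesis by (rule Lim_transform_eventually)
qed

text \<open>
  A Toeplitz argument: if the coefficients of \<open>E\<close> are negligible against those of \<open>P\<close>, then the
  convolution of \<open>E\<close> with \<open>U\<close> is negligible against any bound \<open>w\<close> for that of \<open>P\<close> with \<open>U\<close>. The
  indices past some \<open>I\<close> contribute at most \<open>\<epsilon> * (P * U)\<close>; each of the finitely many others
  contributes a fixed multiple of \<open>U $ (n - i)\<close>, which the last hypothesis makes negligible.
\<close>

lemma fps_mult_nth_little_o:
  fixes E P U :: "real fps"
  assumes E: "\<And>\<epsilon>. \<epsilon> > 0 \<Longrightarrow> \<forall>\<^sub>F i in sequentially. \<bar>E $ i\<bar> \<le> \<epsilon> * P $ i"
    and P: "\<And>i. P $ i \<ge> 0" and U: "\<And>i. U $ i \<ge> 0"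
    and w: "\<forall>\<^sub>F n in sequentially. w n > 0 \<and> (P * U) $ n \<le> C * w n"
    and neg: "\<And>i. (\<lambda>n. U $ (n - i) / w n) \<longlonglongrightarrow> 0"
  shows "(\<lambda>n. (E * U) $ n / w n) \<longlonglongrightarrow> 0"
proof (rule tendstoI)
  fix e :: real assume "e > 0"
  define \<epsilon> where "\<epsilon> = e / (2 * (\<bar>C\<bar> + 1))"
  have eps: "\<epsilon> > 0" using \<open>e > 0\<close> by (simp add: \<epsilon>_def)
  obtain I where I: "\<And>i. i \<ge> I \<Longrightarrow> \<bar>E $ i\<bar> \<le> \<epsilon> * P $ i"
    using E[OF eps] by (auto simp: eventually_sequentially)
  have "(\<lambda>n. \<Sum>i<I. \<bar>E $ i\<bar> * (U $ (n - i) / w n)) \<longlonglongrightarrow> (\<Sum>i<I. \<bar>E $ i\<bar> * 0)"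
    by (intro tendsto_sum tendsto_mult neg tendsto_const)
  then have "(\<lambda>n. \<Sum>i<I. \<bar>E $ i\<bar> * (U $ (n - i) / w n)) \<longlonglongrightarrow> 0" by simp
  from order_tendstoD(2)[OF this, of "e/2"] \<open>e > 0\<close>
  have "\<forall>\<^sub>F n in sequentially. (\<Sum>i<I. \<bar>E $ i\<bar> * (U $ (n - i) / w n)) < e / 2" by simp
  with w eventually_ge_at_top[of I]
  show "\<forall>\<^sub>F n in sequentially. dist ((E * U) $ n / w n) 0 < e"
  proof eventually_elim
    case (elim n)
    then have wn: "w n > 0" by simp
    have "\<bar>(E * U) $ n\<bar> \<le> (\<Sum>i\<le>n. \<bar>E $ i\<bar> * U $ (n - i))"
      unfolding fps_mult_nth atMost_atLeast0
      by (rule order_trans[OF sum_abs]) (simp add: abs_mult U)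
    also have "\<dots> \<le> (\<Sum>i\<le>n. \<epsilon> * (P $ i * U $ (n - i)) + (if i < I then \<bar>E $ i\<bar> * U $ (n - i) else 0))"
    proof (intro sum_mono)
      fix i
      show "\<bar>E $ i\<bar> * U $ (n - i)
        \<le> \<epsilon> * (P $ i * U $ (n - i)) + (if i < I then \<bar>E $ i\<bar> * U $ (n - i) else 0)"
        using I[of i] U[of "n-i"] P[of i] eps mult_right_mono[of "\<bar>E $ i\<bar>" "\<epsilon> * P $ i" "U $ (n-i)"]
        by (auto simp: mult.assoc)
    qed
    also have "\<dots> = \<epsilon> * (P * U) $ n + (\<Sum>i<I. \<bar>E $ i\<bar> * U $ (n - i))"
      using elim by (auto simp: sum.distrib fps_mult_nth atMost_atLeast0 sum_distrib_left
          sum.If_cases Int_def intro!: sum.cong)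
    also have "\<dots> \<le> \<epsilon> * (\<bar>C\<bar> * w n) + (\<Sum>i<I. \<bar>E $ i\<bar> * U $ (n - i))"
      using eps elim mult_right_mono[OF abs_ge_self[of C], of "w n"]
      by (intro add_right_mono mult_left_mono) linarith+
    finally have "\<bar>(E * U) $ n\<bar> / w n
        \<le> (\<epsilon> * (\<bar>C\<bar> * w n) + (\<Sum>i<I. \<bar>E $ i\<bar> * U $ (n - i))) / w n"
      using wn by (simp add: divide_right_mono)
    also have "\<dots> = \<epsilon> * \<bar>C\<bar> + (\<Sum>i<I. \<bar>E $ i\<bar> * (U $ (n - i) / w n))"
      using wn by (simp add: add_divide_distrib sum_divide_distrib)
    also have "\<epsilon> * \<bar>C\<bar> \<le> e / 2"
      using \<open>e > 0\<close> by (simp add: \<epsilon>_def field_simps)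
    finally show ?case using elim by simp
  qed
qed

section \<open>Monotone sequences\<close>

text \<open>
  Kaluza's theorem. With \<open>D = (1 - X) * L\<close>, so that \<open>A * D = 1\<close>, the differences of \<open>L\<close> are the
  coefficients \<open>D $ Suc n\<close>. Eliminating \<open>D $ 0\<close> between the equations for the coefficients \<open>n\<close> and
  \<open>Suc n\<close> of \<open>A * D\<close> writes \<open>D $ Suc n\<close> as a combination of its predecessors, whose coefficients
  are nonnegative because log-convexity makes the ratios \<open>A $ Suc m / A $ m\<close> increase in \<open>m\<close>.
\<close>

lemma quotient_1_minus_X_decreasing:
  fixes A L :: "real fps"
  assumes AL: "A * L = Abs_fps (\<lambda>_. 1)"
    and pos: "\<And>n. A $ n > 0"
    and logconvex: "\<And>n. (A $ Suc n)\<^sup>2 \<le> A $ n * A $ Suc (Suc n)"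
  shows "L $ Suc n \<le> L $ n"
proof -
  define D where "D = (1 - fps_X) * L"
  have D_Suc: "D $ Suc n = L $ Suc n - L $ n" for n
    by (simp add: D_def left_diff_distrib)
  have AD: "A * D = 1"
  proof -
    have "(1 - fps_X) * Abs_fps (\<lambda>_. 1 :: real) = 1"
      by (rule fps_ext) (simp add: left_diff_distrib)
    then show ?thesis unfolding D_def using AL by (metis mult.left_commute)
  qed
  have ratio: "A $ Suc m * A $ n \<le> A $ Suc n * A $ m" if "m \<le> n" for m n
    using that
  proof (induction n rule: dec_induct)
    case (step n)
    have "A $ Suc m * A $ Suc n * A $ Suc n \<le> A $ Suc m * (A $ n * A $ Suc (Suc n))"
      using logconvex[of n] pos[of "Suc m"] by (simp add: power2_eq_square)
    also have "\<dots> \<le> A $ Suc n * A $ m * A $ Suc (Suc n)"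
      using mult_right_mono[OF step.IH, of "A $ Suc (Suc n)"] pos[of "Suc (Suc n)"]
      by (simp add: mult_ac)
    finally show ?case using pos[of "Suc n"] by (simp add: mult_ac)
  qed simp
  have "D $ Suc n \<le> 0" for n
  proof (induction n rule: less_induct)
    case (less n)
    have D0: "A $ 0 * D $ 0 = 1" using AD by (metis fps_mult_nth_0 fps_one_nth)
    \<comment> \<open>Coefficient \<open>Suc k\<close> of \<open>A * D = 1\<close>, with the term of \<open>D $ 0\<close> on the other side.\<close>
    have zero: "(\<Sum>i\<le>k. A $ (Suc k - Suc i) * D $ Suc i) = - A $ Suc k * D $ 0" for k
    proof -
      have "(D * A) $ Suc k = 0" using AD by (simp add: mult.commute)
      then have "(\<Sum>i\<le>Suc k. D $ i * A $ (Suc k - i)) = 0"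
        by (simp add: fps_mult_nth atMost_atLeast0)
      then show ?thesis by (subst (asm) sum.atMost_Suc_shift) (simp add: mult_ac)
    qed
    show ?case
    proof (cases n)
      case 0
      have "A $ 0 * D $ 1 = - A $ 1 * D $ 0" using zero[of 0] by simp
      moreover have "D $ 0 > 0" using D0 pos[of 0] by (metis zero_less_mult_pos zero_less_one)
      ultimately have "A $ 0 * D $ 1 < 0" using pos[of 1] by simp
      then show ?thesis using 0 pos[of 0] by (simp add: mult_less_0_iff)
    next
      case (Suc k)
      have "A $ 0 * D $ Suc n * A $ Suc k
          = - A $ Suc n * D $ 0 * A $ Suc k - (\<Sum>i\<le>k. A $ (Suc n - Suc i) * D $ Suc i) * A $ Suc k"
      proof -
        have "A $ 0 * D $ Suc n = - A $ Suc n * D $ 0 - (\<Sum>i\<le>k. A $ (Suc n - Suc i) * D $ Suc i)"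
          using zero[of n] Suc by simp
        then show ?thesis by (simp only: left_diff_distrib)
      qed
      also have "\<dots> = (\<Sum>i\<le>k. D $ Suc i * (A $ (Suc k - Suc i) * A $ Suc n - A $ (Suc n - Suc i) * A $ Suc k))"
      proof -
        have "- A $ Suc n * D $ 0 * A $ Suc k = (\<Sum>i\<le>k. A $ (Suc k - Suc i) * D $ Suc i) * A $ Suc n"
          unfolding zero[of k] by simp
        then show ?thesis
          by (simp add: sum_distrib_left sum_distrib_right right_diff_distrib sum_subtractf mult_ac)
      qed
      also have "\<dots> \<le> 0"
      proof (intro sum_nonpos)
        fix i assume i: "i \<in> {..k}"
        have "A $ (Suc n - Suc i) * A $ Suc k \<le> A $ (Suc k - Suc i) * A $ Suc n"
          using ratio[of "k - i" "Suc k"] i Suc by (simp add: Suc_diff_le mult_ac)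
        moreover have "D $ Suc i \<le> 0" using less[of i] i Suc by simp
        ultimately show "D $ Suc i * (A $ (Suc k - Suc i) * A $ Suc n - A $ (Suc n - Suc i) * A $ Suc k) \<le> 0"
          by (simp add: mult_nonpos_nonneg)
      qed
      finally show ?thesis using pos[of 0] pos[of "Suc k"]
        by (simp add: mult_le_0_iff not_le)
    qed
  qed
  then show ?thesis using D_Suc[of n] by (metis diff_le_0_iff_le)
qed

text \<open>
  The slope of the partial sums between \<open>n\<close> and \<open>m\<close>, with \<open>m\<close> close to \<open>\<rho> * n\<close>, bounds \<open>l n\<close> from below if
  \<open>\<rho> > 1\<close> and from above if \<open>\<rho> < 1\<close>, because \<open>l\<close> decreases. After rescaling, these slopes tend
  to \<open>C * (\<rho> powr \<beta> - 1) / (\<rho> - 1)\<close>, a difference quotient of the power function, and letting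
  \<open>\<rho>\<close> tend to 1 gives \<open>C * \<beta>\<close>.
\<close>

lemma monotone_density:
  fixes l :: "nat \<Rightarrow> real"
  assumes "decseq l" and "\<beta> > 0"
    and lim: "(\<lambda>n. (\<Sum>i\<le>n. l i) / real n powr \<beta>) \<longlonglongrightarrow> C"
  shows "(\<lambda>n. l n * real n powr (1 - \<beta>)) \<longlonglongrightarrow> C * \<beta>"
proof -
  define S where "S n = (\<Sum>i\<le>n. l i)" for n
  define slope where "slope \<rho> = C * ((\<rho> powr \<beta> - 1) / (\<rho> - 1))" for \<rho> :: real
  define m where "m \<rho> n = nat \<lfloor>\<rho> * real n\<rfloor>" for \<rho> :: real and n
  \<comment> \<open>Since \<open>m \<rho> n / n\<close> tends to \<open>\<rho>\<close>, the hypothesis applies along both \<open>m \<rho> n\<close> and \<open>n\<close>.\<close>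
  have quot: "(\<lambda>n. (S (m \<rho> n) - S n) / (real (m \<rho> n) - real n) * real n powr (1 - \<beta>)) \<longlonglongrightarrow> slope \<rho>"
    if "\<rho> > 0" "\<rho> \<noteq> 1" for \<rho>
  proof -
    have m_over: "(\<lambda>n. real (m \<rho> n) / real n) \<longlonglongrightarrow> \<rho>"
    proof -
      have "(\<lambda>n. real_of_int \<lfloor>\<rho> * real n\<rfloor> / real n) \<longlonglongrightarrow> \<rho>" by real_asymp
      moreover have "real (m \<rho> n) = real_of_int \<lfloor>\<rho> * real n\<rfloor>" for n
        using that by (simp add: m_def)
      ultimately show ?thesis by simp
    qed
    have m_top: "filterlim (m \<rho>) at_top sequentially"
      unfolding m_def using that
      by (intro filterlim_compose[OF filterlim_nat_sequentially] filterlim_compose[OF filterlim_floor_sequentially]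
          filterlim_tendsto_pos_mult_at_top[OF tendsto_const] filterlim_real_sequentially)
    have "(\<lambda>n. (S (m \<rho> n) / real (m \<rho> n) powr \<beta> * (real (m \<rho> n) / real n) powr \<beta> - S n / real n powr \<beta>)
        / (real (m \<rho> n) / real n - 1)) \<longlonglongrightarrow> (C * \<rho> powr \<beta> - C) / (\<rho> - 1)"
      using that lim unfolding S_def
      by (intro tendsto_intros m_over filterlim_compose[OF lim m_top]) auto
    moreover have "\<forall>\<^sub>F n in sequentially.
       (S (m \<rho> n) / real (m \<rho> n) powr \<beta> * (real (m \<rho> n) / real n) powr \<beta> - S n / real n powr \<beta>)
        / (real (m \<rho> n) / real n - 1) = (S (m \<rho> n) - S n) / (real (m \<rho> n) - real n) * real n powr (1 - \<beta>)"
      using eventually_gt_at_top[of 0] m_top[unfolded filterlim_at_top, rule_format, of 1]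
    proof eventually_elim
      case (elim n)
      have "(real (m \<rho> n) / real n) powr \<beta> = real (m \<rho> n) powr \<beta> / real n powr \<beta>"
        by (rule powr_divide)
      moreover have "real n powr (1 - \<beta>) = real n / real n powr \<beta>"
        using elim by (simp add: powr_diff)
      moreover have "real (m \<rho> n) / real n - 1 = (real (m \<rho> n) - real n) / real n"
        using elim by (simp add: field_simps)
      moreover have "(x / y * (y / z) - w / z) / (d / r) = (x - w) / d * (r / z)"
        if "y \<noteq> 0" for x y z w d r :: real
        using that by (simp add: diff_divide_distrib[symmetric])
      ultimately show ?case using elim by (simp only:) (auto simp: diff_divide_distrib[symmetric])
    qed
    ultimately have "(\<lambda>n. (S (m \<rho> n) - S n) / (real (m \<rho> n) - real n) * real n powr (1 - \<beta>))
        \<longlonglongrightarrow> (C * \<rho> powr \<beta> - C) / (\<rho> - 1)" by (rule Lim_transform_eventually)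
    then show ?thesis by (simp add: slope_def right_diff_distrib)
  qed
  have diff: "S b - S a = sum l {a<..b}" if "a \<le> b" for a b
    unfolding S_def using that
    by (subst sum_diff[symmetric]) (auto intro!: sum.cong)
  have upper: "l n \<le> (S k - S n) / (real k - real n)" if "k < n" for k n
  proof -
    have "(\<Sum>i\<in>{k<..n}. l n) \<le> sum l {k<..n}"
      using \<open>decseq l\<close> by (intro sum_mono) (auto simp: decseq_def)
    then have "real (n - k) * l n \<le> S n - S k" using diff[of k n] that by simp
    then show ?thesis using that by (simp add: of_nat_diff field_simps)
  qed
  have lower: "(S k - S n) / (real k - real n) \<le> l n" if "n < k" for k n
  proof -
    have "sum l {n<..k} \<le> (\<Sum>i\<in>{n<..k}. l n)"
      using \<open>decseq l\<close> by (intro sum_mono) (auto simp: decseq_def)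
    then have "S k - S n \<le> real (k - n) * l n" using diff[of n k] that by simp
    then show ?thesis using that by (simp add: of_nat_diff field_simps)
  qed
  have slope_lim: "(slope \<longlongrightarrow> C * \<beta>) (at 1)"
  proof -
    have "((\<lambda>\<rho>. \<rho> powr \<beta>) has_real_derivative \<beta>) (at 1)"
      by (auto intro!: derivative_eq_intros)
    then show ?thesis unfolding slope_def has_field_derivative_iff
      by (intro tendsto_intros) simp
  qed
  show ?thesis
  proof (rule order_tendstoI)
    fix x assume "x < C * \<beta>"
    with slope_lim have "\<forall>\<^sub>F \<rho> in at_right 1. x < slope \<rho>"
      by (auto dest: order_tendstoD simp: eventually_at_split)
    from eventually_happens[OF eventually_conj[OF this eventually_at_right_less]]
    obtain \<rho> where rho: "\<rho> > 1" "x < slope \<rho>" by auto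
    have "\<forall>\<^sub>F n in sequentially. real n < real_of_int \<lfloor>\<rho> * real n\<rfloor>" using rho(1) by real_asymp
    with order_tendstoD(1)[OF quot rho(2)] rho(1)
    show "\<forall>\<^sub>F n in sequentially. x < l n * real n powr (1 - \<beta>)"
    proof (simp, elim eventually_rev_mp, intro always_eventually allI impI)
      fix n assume n: "real n < real_of_int \<lfloor>\<rho> * real n\<rfloor>"
        and *: "x < (S (m \<rho> n) - S n) * real n powr (1 - \<beta>) / (real (m \<rho> n) - real n)"
      have "n < m \<rho> n" using n unfolding m_def by linarith
      from mult_right_mono[OF lower[OF this], of "real n powr (1 - \<beta>)"] *
      show "x < l n * real n powr (1 - \<beta>)" by simp
    qed
  next
    fix x assume "C * \<beta> < x"
    with slope_lim have ev: "\<forall>\<^sub>F \<rho> in at_left 1. slope \<rho> < x"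
      by (auto dest: order_tendstoD simp: eventually_at_split)
    have "\<forall>\<^sub>F \<rho>::real in at_left 1. 0 < \<rho> \<and> \<rho> < 1"
      using eventually_at_left_real[of 0 1] by simp
    from eventually_happens[OF eventually_conj[OF ev this]]
    obtain \<rho> where rho: "\<rho> > 0" "\<rho> < 1" "slope \<rho> < x" by auto
    have "\<forall>\<^sub>F n in sequentially. \<rho> * real n < real n" using rho(2) by real_asymp
    with order_tendstoD(2)[OF quot rho(3)] rho(1,2)
    show "\<forall>\<^sub>F n in sequentially. l n * real n powr (1 - \<beta>) < x"
    proof (simp, elim eventually_rev_mp, intro always_eventually allI impI)
      fix n assume n: "\<rho> * real n < real n"
        and *: "(S (m \<rho> n) - S n) * real n powr (1 - \<beta>) / (real (m \<rho> n) - real n) < x"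
      have "m \<rho> n < n" using n rho(1) unfolding m_def by (simp add: nat_less_iff floor_less_iff)
      from mult_right_mono[OF upper[OF this], of "real n powr (1 - \<beta>)"] *
      show "l n * real n powr (1 - \<beta>) < x" by simp
    qed
  qed
qed

section \<open>Asymptotics of the Caputo weights\<close>

lemma caputo_weight_1: "caputo_weight \<alpha> (Suc 0) = 1"
  by simp

definition weight_fps :: "real \<Rightarrow> real fps" where
  "weight_fps \<alpha> = Abs_fps (\<lambda>m. caputo_weight \<alpha> (Suc m))"

text \<open>
  The coefficients are the values of the Riemann-Liouville kernel \<open>t powr (\<alpha> - 1)\<close> at the positive integers.
\<close>

definition kernel_fps :: "real \<Rightarrow> real fps" where
  "kernel_fps \<alpha> = Abs_fps (\<lambda>m. real (Suc m) powr (\<alpha> - 1))"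

text \<open>
  The recursion for the weights says exactly that they are the resolvent of the kernel: the
  differences of the kernel make the convolution the same at \<open>Suc k\<close> as at \<open>k\<close>.
\<close>

lemma kernel_times_weight: "kernel_fps \<alpha> * weight_fps \<alpha> = Abs_fps (\<lambda>_. 1)"
proof (rule fps_ext)
  fix n
  have "(\<Sum>i\<le>n. weight_fps \<alpha> $ i * kernel_fps \<alpha> $ (n - i)) = 1"
  proof (induction n)
    case 0
    show ?case by (simp add: weight_fps_def kernel_fps_def)
  next
    case (Suc k)
    have "weight_fps \<alpha> $ Suc k = (\<Sum>j=Suc 0..Suc k.
        ((real (Suc k) - real j + 1) powr (\<alpha> - 1) - (real (Suc k) - real j + 2) powr (\<alpha> - 1))
        * caputo_weight \<alpha> j)"
      unfolding weight_fps_def fps_nth_Abs_fps caputo_weight.simps(2)[of _ "Suc k"] by simp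
    also have "\<dots> = (\<Sum>i\<le>k. ((real (Suc k) - real (Suc i) + 1) powr (\<alpha> - 1)
        - (real (Suc k) - real (Suc i) + 2) powr (\<alpha> - 1)) * caputo_weight \<alpha> (Suc i))"
      unfolding sum.atLeast_Suc_atMost_Suc_shift atMost_atLeast0 comp_def ..
    also have "\<dots> = (\<Sum>i\<le>k. weight_fps \<alpha> $ i * kernel_fps \<alpha> $ (k - i)
        - weight_fps \<alpha> $ i * kernel_fps \<alpha> $ (Suc k - i))"
    proof (intro sum.cong refl)
      fix i assume "i \<in> {..k}"
      then have "real (Suc (k - i)) = real (Suc k) - real (Suc i) + 1"
        "real (Suc (Suc k - i)) = real (Suc k) - real (Suc i) + 2" by (auto simp: of_nat_diff)
      then show "((real (Suc k) - real (Suc i) + 1) powr (\<alpha> - 1)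
        - (real (Suc k) - real (Suc i) + 2) powr (\<alpha> - 1)) * caputo_weight \<alpha> (Suc i)
        = weight_fps \<alpha> $ i * kernel_fps \<alpha> $ (k - i)
        - weight_fps \<alpha> $ i * kernel_fps \<alpha> $ (Suc k - i)"
        unfolding weight_fps_def kernel_fps_def fps_nth_Abs_fps
        by (simp only: left_diff_distrib right_diff_distrib mult.commute)
    qed
    finally show ?case using Suc.IH by (simp add: sum_subtractf kernel_fps_def)
  qed
  then show "(kernel_fps \<alpha> * weight_fps \<alpha>) $ n = Abs_fps (\<lambda>_. 1) $ n"
    by (simp add: mult.commute[of "kernel_fps \<alpha>"] fps_mult_nth atMost_atLeast0)
qed

declare caputo_weight.simps [simp del]

context
  fixes \<alpha> :: real
  assumes alpha: "0 < \<alpha>" "\<alpha> < 1"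
begin

lemma caputo_weight_nonneg: "caputo_weight \<alpha> k \<ge> 0"
proof (induction k rule: less_induct)
  case (less k)
  show ?case
  proof (cases k)
    case (Suc m)
    have "(real m - real j + 2) powr (\<alpha> - 1) \<le> (real m - real j + 1) powr (\<alpha> - 1)"
      if "j \<le> m" for j
      using that alpha by (intro powr_mono2') auto
    then show ?thesis using Suc less by (auto simp: caputo_weight.simps intro!: sum_nonneg mult_nonneg_nonneg)
  qed (simp add: caputo_weight.simps)
qed

text \<open>
  Log-convexity of the kernel is the inequality \<open>(n + 1) * (n + 3) \<le> (n + 2)\<^sup>2\<close>.
\<close>

lemma caputo_weight_decreasing: "decseq (\<lambda>m. caputo_weight \<alpha> (Suc m))"
proof -
  have "(kernel_fps \<alpha> $ Suc n)\<^sup>2 \<le> kernel_fps \<alpha> $ n * kernel_fps \<alpha> $ Suc (Suc n)" for n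
  proof -
    have "(real (Suc (Suc n)) * real (Suc (Suc n))) powr (\<alpha> - 1)
        \<le> (real (Suc n) * real (Suc (Suc (Suc n)))) powr (\<alpha> - 1)"
      using alpha by (intro powr_mono2') (auto simp: algebra_simps intro!: add_pos_nonneg)
    then show ?thesis
      unfolding kernel_fps_def fps_nth_Abs_fps power2_eq_square by (simp only: powr_mult)
  qed
  then have "weight_fps \<alpha> $ Suc n \<le> weight_fps \<alpha> $ n" for n
    by (intro quotient_1_minus_X_decreasing[OF kernel_times_weight])
       (auto simp: kernel_fps_def simp del: of_nat_Suc)
  then show ?thesis by (simp add: decseq_Suc_iff weight_fps_def)
qed

text \<open>
  On \<open>{..n}\<close> the kernel is at least its last value, and its convolution with the weights is 1.
\<close>

lemma sum_caputo_weight_le: "(\<Sum>i\<le>n. weight_fps \<alpha> $ i) \<le> real (Suc n) powr (1 - \<alpha>)"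
proof -
  have "(\<Sum>i\<le>n. weight_fps \<alpha> $ i) * real (Suc n) powr (\<alpha> - 1)
      \<le> (\<Sum>i\<le>n. weight_fps \<alpha> $ i * kernel_fps \<alpha> $ (n - i))"
    unfolding sum_distrib_right
  proof (intro sum_mono mult_left_mono)
    fix i
    show "real (Suc n) powr (\<alpha> - 1) \<le> kernel_fps \<alpha> $ (n - i)"
      unfolding kernel_fps_def fps_nth_Abs_fps using alpha by (intro powr_mono2') auto
  qed (simp add: weight_fps_def caputo_weight_nonneg)
  also have "\<dots> = 1"
    using arg_cong[OF kernel_times_weight[of \<alpha>], of "\<lambda>f. f $ n"]
    by (simp add: mult.commute[of "kernel_fps \<alpha>"] fps_mult_nth atMost_atLeast0)
  finally show ?thesis
    by (simp add: powr_diff powr_minus field_simps del: of_nat_Suc)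
qed

text \<open>
  For a decreasing sequence the last term is at most the average. This pointwise bound, at every
  scale \<open>\<tau>\<close>, is what makes dominated convergence available below.
\<close>

lemma caputo_weight_le: "caputo_weight \<alpha> k \<le> real k powr (- \<alpha>)"
proof (cases k)
  case (Suc n)
  have "real (Suc n) * caputo_weight \<alpha> (Suc n) = (\<Sum>i\<le>n. caputo_weight \<alpha> (Suc n))"
    by simp
  also have "\<dots> \<le> (\<Sum>i\<le>n. weight_fps \<alpha> $ i)"
    using caputo_weight_decreasing unfolding weight_fps_def fps_nth_Abs_fps
    by (intro sum_mono) (auto simp: decseq_def)
  also have "\<dots> \<le> real (Suc n) * real (Suc n) powr (- \<alpha>)"
    using sum_caputo_weight_le[of n] by (simp add: powr_diff powr_minus field_simps del: of_nat_Suc)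
  finally show ?thesis using Suc by simp
qed (simp add: caputo_weight.simps)

text \<open>
  With \<open>P\<close> and \<open>Q\<close> the expansions of \<open>(1 - X)\<close> to the powers \<open>- \<alpha>\<close> and \<open>\<alpha> - 1\<close>, the kernel is
  \<open>Gamma \<alpha> * P + E\<close> with \<open>E\<close> negligible against \<open>P\<close>. Multiplying the resolvent equation by \<open>Q\<close>
  turns \<open>P\<close> into the summation series \<open>1 / (1 - X)\<close>, so \<open>Gamma \<alpha>\<close> times the partial sums of the
  weights is the explicit series of exponent \<open>2 - \<alpha>\<close>, up to the error \<open>E * Q * L\<close>. Two
  applications of the Toeplitz estimate, first to \<open>E * Q\<close> and then to its product with \<open>L\<close>, show
  that the error is negligible.
\<close>

lemma sum_caputo_weight_asymp:
  "(\<lambda>n. (\<Sum>i\<le>n. weight_fps \<alpha> $ i) / real n powr (1 - \<alpha>)) \<longlonglongrightarrow> 1 / (Gamma \<alpha> * Gamma (2 - \<alpha>))"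
proof -
  define P Q L where "P = neg_binomial_fps \<alpha>" and "Q = neg_binomial_fps (1 - \<alpha>)" and "L = weight_fps \<alpha>"
  define E where "E = kernel_fps \<alpha> - fps_const (Gamma \<alpha>) * P"
  have G: "Gamma \<alpha> > 0" using alpha by simp
  then have G0: "Gamma \<alpha> \<noteq> 0" by linarith
  have PQ: "P * Q = Abs_fps (\<lambda>_. 1)"
    unfolding P_def Q_def neg_binomial_fps_add[symmetric] neg_binomial_fps_1[symmetric] by simp
  have sum_L: "(Abs_fps (\<lambda>_. 1) * L) $ n = (\<Sum>i\<le>n. L $ i)" for n
    unfolding mult.commute[of _ L] by (simp add: fps_mult_nth atMost_atLeast0)
  have P_asymp: "(\<lambda>n. P $ n / real n powr (\<alpha> - 1)) \<longlonglongrightarrow> 1 / Gamma \<alpha>"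
    unfolding P_def using alpha by (intro neg_binomial_fps_asymp) auto
  have E_small: "\<forall>\<^sub>F i in sequentially. \<bar>E $ i\<bar> \<le> \<epsilon> * P $ i" if "\<epsilon> > 0" for \<epsilon>
  proof -
    have "(\<lambda>n. (real (Suc n) / real n) powr (\<alpha> - 1) / (P $ n / real n powr (\<alpha> - 1)) - Gamma \<alpha>)
        \<longlonglongrightarrow> 1 powr (\<alpha> - 1) / (1 / Gamma \<alpha>) - Gamma \<alpha>"
      by (intro tendsto_intros P_asymp LIMSEQ_Suc_n_over_n) (use G in auto)
    then have "(\<lambda>n. \<bar>(real (Suc n) / real n) powr (\<alpha> - 1) / (P $ n / real n powr (\<alpha> - 1)) - Gamma \<alpha>\<bar>)
        \<longlonglongrightarrow> 0" using tendsto_rabs_zero by simp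
    from order_tendstoD(2)[OF this that] eventually_gt_at_top[of 0]
    show ?thesis
    proof eventually_elim
      case (elim n)
      have pos: "P $ n > 0" using alpha by (simp add: P_def neg_binomial_fps_def pochhammer_pos)
      have "(real (Suc n) / real n) powr (\<alpha> - 1) = real (Suc n) powr (\<alpha> - 1) / real n powr (\<alpha> - 1)"
        by (rule powr_divide)
      then have "(real (Suc n) / real n) powr (\<alpha> - 1) / (P $ n / real n powr (\<alpha> - 1)) - Gamma \<alpha> = E $ n / P $ n"
        using pos elim by (simp add: E_def kernel_fps_def diff_divide_distrib del: of_nat_Suc)
      with elim have "\<bar>E $ n / P $ n\<bar> < \<epsilon>" by simp
      then show ?case using pos by (simp add: abs_divide pos_divide_less_eq)
    qed
  qed
  have Q0: "Q $ n \<ge> 0" for n using alpha by (simp add: Q_def neg_binomial_fps_nonneg)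
  have P0: "P $ n \<ge> 0" for n using alpha by (simp add: P_def neg_binomial_fps_nonneg)
  have L0: "L $ n \<ge> 0" for n by (simp add: L_def weight_fps_def caputo_weight_nonneg)
  have L1: "L $ n \<le> 1" for n
    using decseqD[OF caputo_weight_decreasing, of 0 n]
    by (simp add: L_def weight_fps_def caputo_weight_1)
  have "(\<lambda>n. Q $ n / real n powr (1 - \<alpha> - 1) * real n powr (- \<alpha>)) \<longlonglongrightarrow> 1 / Gamma (1 - \<alpha>) * 0"
    unfolding Q_def using alpha
    by (intro tendsto_mult neg_binomial_fps_asymp tendsto_neg_powr filterlim_real_sequentially) auto
  then have Q_aux: "(\<lambda>n. Q $ n / real n powr (1 - \<alpha> - 1) * real n powr (- \<alpha>)) \<longlonglongrightarrow> 0" by simp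
  have Q_lim: "(\<lambda>n. Q $ n) \<longlonglongrightarrow> 0"
  proof (rule Lim_transform_eventually)
    show "(\<lambda>n. Q $ n / real n powr (1 - \<alpha> - 1) * real n powr (- \<alpha>)) \<longlonglongrightarrow> 0" by (rule Q_aux)
  qed (use eventually_gt_at_top[of 0] in \<open>eventually_elim, simp\<close>)
  have EQ: "(\<lambda>n. (E * Q) $ n / 1) \<longlonglongrightarrow> 0"
  proof (rule fps_mult_nth_little_o[where P = P and C = 1])
    show "(\<lambda>n. Q $ (n - i) / 1) \<longlonglongrightarrow> 0" for i
      using filterlim_compose[OF Q_lim filterlim_minus_const_nat_at_top] by simp
  qed (use E_small P0 Q0 PQ in auto)
  have EQL: "(\<lambda>n. (E * Q * L) $ n / real n powr (1 - \<alpha>)) \<longlonglongrightarrow> 0"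
  proof (rule fps_mult_nth_little_o[where P = "Abs_fps (\<lambda>_. 1)" and C = 2])
    fix e :: real assume "e > 0"
    with EQ have "\<forall>\<^sub>F i in sequentially. \<bar>(E * Q) $ i\<bar> < e"
      using order_tendstoD(2)[OF tendsto_rabs_zero, of "\<lambda>n. (E * Q) $ n" sequentially e] by simp
    then show "\<forall>\<^sub>F i in sequentially. \<bar>(E * Q) $ i\<bar> \<le> e * Abs_fps (\<lambda>_. 1) $ i"
      by eventually_elim simp
  next
    show "\<forall>\<^sub>F n in sequentially. 0 < real n powr (1 - \<alpha>) \<and> (Abs_fps (\<lambda>_. 1) * L) $ n \<le> 2 * real n powr (1 - \<alpha>)"
      using eventually_gt_at_top[of 0]
    proof eventually_elim
      case (elim n)
      have "real (Suc n) powr (1 - \<alpha>) \<le> (2 * real n) powr (1 - \<alpha>)"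
        using elim alpha by (intro powr_mono2) auto
      also have "\<dots> = 2 powr (1 - \<alpha>) * real n powr (1 - \<alpha>)" by (rule powr_mult)
      also have "\<dots> \<le> 2 powr 1 * real n powr (1 - \<alpha>)"
        using alpha by (intro mult_right_mono powr_mono) auto
      finally show ?case
        using elim sum_caputo_weight_le[of n, folded L_def] unfolding sum_L by simp
    qed
  next
    have "(\<lambda>n. 1 / real n powr (1 - \<alpha>)) \<longlonglongrightarrow> 0" using alpha by real_asymp
    then show "(\<lambda>n. L $ (n - i) / real n powr (1 - \<alpha>)) \<longlonglongrightarrow> 0" for i
      by (rule tendsto_sandwich[OF _ _ tendsto_const, rotated 2])
         (use L0 L1 in \<open>auto intro!: always_eventually divide_right_mono\<close>)
  qed (use L0 in auto)
  have split: "Gamma \<alpha> * (\<Sum>i\<le>n. L $ i) = neg_binomial_fps (2 - \<alpha>) $ n - (E * Q * L) $ n" for n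
  proof -
    have "neg_binomial_fps (2 - \<alpha>) = Abs_fps (\<lambda>_. 1) * Q"
      unfolding Q_def neg_binomial_fps_1[symmetric] neg_binomial_fps_add[symmetric] by simp
    also have "\<dots> = (E + fps_const (Gamma \<alpha>) * P) * L * Q"
      unfolding E_def L_def using kernel_times_weight by simp
    also have "\<dots> = E * Q * L + fps_const (Gamma \<alpha>) * ((P * Q) * L)"
      by (simp add: algebra_simps)
    finally have "neg_binomial_fps (2 - \<alpha>) $ n = (E * Q * L) $ n + Gamma \<alpha> * (Abs_fps (\<lambda>_. 1) * L) $ n"
      unfolding PQ by simp
    then show ?thesis unfolding sum_L by simp
  qed
  have "(\<lambda>n. (neg_binomial_fps (2 - \<alpha>) $ n / real n powr (2 - \<alpha> - 1) - (E * Q * L) $ n / real n powr (1 - \<alpha>)) / Gamma \<alpha>)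
      \<longlonglongrightarrow> (1 / Gamma (2 - \<alpha>) - 0) / Gamma \<alpha>"
    using alpha by (intro tendsto_divide[OF tendsto_diff[OF neg_binomial_fps_asymp EQL] tendsto_const G0]) auto
  moreover have "(neg_binomial_fps (2 - \<alpha>) $ n / real n powr (2 - \<alpha> - 1) - (E * Q * L) $ n / real n powr (1 - \<alpha>)) / Gamma \<alpha>
      = (\<Sum>i\<le>n. L $ i) / real n powr (1 - \<alpha>)" for n
    using G by (simp add: diff_divide_distrib[symmetric] split[symmetric])
  ultimately show ?thesis unfolding L_def by (simp add: mult.commute)
qed

lemma caputo_weight_asymp:
  "(\<lambda>k. caputo_weight \<alpha> k * real k powr \<alpha>) \<longlonglongrightarrow> 1 / (Gamma \<alpha> * Gamma (1 - \<alpha>))"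
proof -
  have "(\<lambda>n. caputo_weight \<alpha> (Suc n) * real n powr (1 - (1 - \<alpha>)))
      \<longlonglongrightarrow> 1 / (Gamma \<alpha> * Gamma (2 - \<alpha>)) * (1 - \<alpha>)"
    using alpha sum_caputo_weight_asymp
    by (intro monotone_density[OF caputo_weight_decreasing]) (auto simp: weight_fps_def)
  moreover have "Gamma (2 - \<alpha>) = (1 - \<alpha>) * Gamma (1 - \<alpha>)"
    using Gamma_plus1[of "1 - \<alpha>"] alpha by (fastforce elim!: nonpos_Ints_cases)
  ultimately have "(\<lambda>n. caputo_weight \<alpha> (Suc n) * real n powr \<alpha>) \<longlonglongrightarrow> 1 / (Gamma \<alpha> * Gamma (1 - \<alpha>))"
    using alpha by simp
  then have "(\<lambda>n. caputo_weight \<alpha> (Suc n) * real n powr \<alpha> * (real (Suc n) / real n) powr \<alpha>)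
      \<longlonglongrightarrow> 1 / (Gamma \<alpha> * Gamma (1 - \<alpha>)) * 1 powr \<alpha>"
    by (intro tendsto_intros LIMSEQ_Suc_n_over_n) auto
  then have "(\<lambda>n. caputo_weight \<alpha> (Suc n) * real (Suc n) powr \<alpha>)
      \<longlonglongrightarrow> 1 / (Gamma \<alpha> * Gamma (1 - \<alpha>)) * 1 powr \<alpha>"
  proof (rule Lim_transform_eventually)
    show "\<forall>\<^sub>F n in sequentially.
       caputo_weight \<alpha> (Suc n) * real n powr \<alpha> * (real (Suc n) / real n) powr \<alpha>
       = caputo_weight \<alpha> (Suc n) * real (Suc n) powr \<alpha>"
      using eventually_gt_at_top[of 0]
      by eventually_elim (simp add: powr_divide del: of_nat_Suc)
  qed
  then show ?thesis using LIMSEQ_imp_Suc[of "\<lambda>k. caputo_weight \<alpha> k * real k powr \<alpha>"] by simp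
qed

end

section \<open>Integrals over an interval\<close>

lemma set_integral_shift:
  fixes g :: "real \<Rightarrow> real"
  shows "(LINT u:{a<..<b}|lebesgue. g (u + c)) = (LINT s:{a + c<..<b + c}|lebesgue. g s)"
  unfolding set_lebesgue_integral_def
  by (subst (2) lebesgue_integral_real_affine[where c = 1 and t = c])
     (auto intro!: Bochner_Integration.integral_cong simp: add.commute split: split_indicator)

lemma set_integral_FTC:
  fixes F h :: "real \<Rightarrow> real"
  assumes "a \<le> b" and cont: "continuous_on {a..b} F"
    and deriv: "\<And>x. a < x \<Longrightarrow> x < b \<Longrightarrow> (F has_real_derivative h x) (at x)"
    and int: "set_integrable lebesgue {a<..<b} h"
  shows "(LINT x:{a<..<b}|lebesgue. h x) = F b - F a"
proof -
  have "(h has_integral (F b - F a)) {a..b}"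
    using assms by (intro fundamental_theorem_of_calculus_interior)
      (auto simp: has_real_derivative_iff_has_vector_derivative)
  then have "(h has_integral (F b - F a)) {a<..<b}" by (simp add: has_integral_Icc_iff_Ioo)
  then show ?thesis
    using set_lebesgue_integral_eq_integral(2)[OF int] by (simp add: integral_unique)
qed

lemma set_integrable_FTC_nonneg:
  fixes F h :: "real \<Rightarrow> real"
  assumes "a \<le> b" and cont: "continuous_on {a..b} F"
    and deriv: "\<And>x. a < x \<Longrightarrow> x < b \<Longrightarrow> (F has_real_derivative h x) (at x)"
    and nonneg: "\<And>x. a < x \<Longrightarrow> x < b \<Longrightarrow> h x \<ge> 0"
  shows "set_integrable lebesgue {a<..<b} h"
proof -
  have "(h has_integral (F b - F a)) {a..b}"
    using assms by (intro fundamental_theorem_of_calculus_interior)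
      (auto simp: has_real_derivative_iff_has_vector_derivative)
  then have "h integrable_on {a<..<b}" by (auto simp: has_integral_Icc_iff_Ioo integrable_on_def)
  then show ?thesis using nonneg by (intro nonnegative_absolutely_integrable_1) auto
qed

lemma continuous_set_integrable_Ioo:
  fixes h :: "real \<Rightarrow> real"
  assumes "continuous_on {a..b} h"
  shows "set_integrable lebesgue {a<..<b} h"
  using absolutely_integrable_continuous_real[OF assms] by (simp add: absolutely_integrable_on_Icc_iff_Ioo)

lemma deriv_powr_left:
  fixes a r t :: real
  assumes "a < 1" "r < t"
  shows "((\<lambda>t. (t - r) powr (1 - a) / (1 - a)) has_real_derivative 1 / (t - r) powr a) (at t)"
proof -
  have "((\<lambda>t. (t - r) powr (1 - a)) has_real_derivative (1 - a) * (t - r) powr (1 - a - of_nat 1) * 1) (at t)"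
    using assms by (intro DERIV_fun_powr) (auto intro!: derivative_eq_intros)
  from DERIV_cdivide[OF this, of "1 - a"] show ?thesis
    by (rule DERIV_cong) (use assms in \<open>simp add: powr_minus_divide\<close>)
qed

text \<open>
  Both weights are derivatives of functions that stay continuous up to the singularity, and being
  nonnegative they are integrable as soon as these functions have finite increments.
\<close>

lemma integral_powr_endpoint_singularity:
  fixes a r T :: real
  assumes "a < 1" "r \<le> T"
  shows set_integrable_powr_left: "set_integrable lebesgue {r<..<T} (\<lambda>t. 1 / (t - r) powr a)"
    and set_integral_powr_left: "(LINT t:{r<..<T}|lebesgue. 1 / (t - r) powr a) = (T - r) powr (1 - a) / (1 - a)"
    and set_integrable_powr_right: "set_integrable lebesgue {r<..<T} (\<lambda>t. 1 / (T - t) powr a)"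
    and set_integral_powr_right: "(LINT t:{r<..<T}|lebesgue. 1 / (T - t) powr a) = (T - r) powr (1 - a) / (1 - a)"
proof -
  have c1: "continuous_on {r..T} (\<lambda>t. (t - r) powr (1 - a) / (1 - a))"
    and c2: "continuous_on {r..T} (\<lambda>t. - ((T - t) powr (1 - a) / (1 - a)))"
    using assms by (auto intro!: continuous_intros continuous_on_powr')
  note d1 = deriv_powr_left[OF assms(1)]
  have d2: "((\<lambda>t. - ((T - t) powr (1 - a) / (1 - a))) has_real_derivative 1 / (T - t) powr a) (at t)"
    if "t < T" for t
  proof -
    have "((\<lambda>t. (T - t) powr (1 - a)) has_real_derivative (1 - a) * (T - t) powr (1 - a - of_nat 1) * (- 1)) (at t)"
      using that by (intro DERIV_fun_powr) (auto intro!: derivative_eq_intros)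
    from DERIV_minus[OF DERIV_cdivide[OF this, of "1 - a"]] show ?thesis
      by (rule DERIV_cong) (use that assms in \<open>simp add: powr_minus_divide\<close>)
  qed
  show i1: "set_integrable lebesgue {r<..<T} (\<lambda>t. 1 / (t - r) powr a)"
    by (rule set_integrable_FTC_nonneg[OF assms(2) c1]) (use d1 in auto)
  show i2: "set_integrable lebesgue {r<..<T} (\<lambda>t. 1 / (T - t) powr a)"
    by (rule set_integrable_FTC_nonneg[OF assms(2) c2]) (use d2 in auto)
  show "(LINT t:{r<..<T}|lebesgue. 1 / (t - r) powr a) = (T - r) powr (1 - a) / (1 - a)"
    using set_integral_FTC[OF assms(2) c1 _ i1] d1 assms by auto
  show "(LINT t:{r<..<T}|lebesgue. 1 / (T - t) powr a) = (T - r) powr (1 - a) / (1 - a)"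
    using set_integral_FTC[OF assms(2) c2 _ i2] d2 assms by auto
qed

lemma continuous_on_Icc_abs_bound:
  fixes h :: "real \<Rightarrow> real"
  assumes "continuous_on {a..b} h"
  obtains M where "M \<ge> 0" "\<And>t. t \<in> {a..b} \<Longrightarrow> \<bar>h t\<bar> \<le> M"
proof -
  have "bounded (h ` {a..b})"
    by (rule compact_imp_bounded[OF compact_continuous_image[OF assms compact_Icc]])
  then obtain M where M: "\<forall>x\<in>{a..b}. \<bar>h x\<bar> \<le> M" by (auto simp: bounded_iff)
  show ?thesis by (rule that[of "max M 0"]) (use M in \<open>fastforce simp: le_max_iff_disj\<close>)+
qed

section \<open>Step functions and cell integrals\<close>

lemma cell_index_iff:
  assumes "\<tau> > 0" "t > 0"
  shows "t \<in> {(real j - 1) * \<tau> <.. real j * \<tau>} \<longleftrightarrow> j = nat \<lceil>t / \<tau>\<rceil>"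
proof -
  have pos: "t / \<tau> > 0" using assms by simp
  have "t \<in> {(real j - 1) * \<tau> <.. real j * \<tau>} \<longleftrightarrow> real j - 1 < t / \<tau> \<and> t / \<tau> \<le> real j"
    using assms by (simp add: field_simps)
  also have "\<dots> \<longleftrightarrow> \<lceil>t / \<tau>\<rceil> = int j" by (simp add: ceiling_eq_iff)
  also have "\<dots> \<longleftrightarrow> j = nat \<lceil>t / \<tau>\<rceil>" using pos by (auto simp: nat_eq_iff)
  finally show ?thesis .
qed

lemma cell_index_bounds:
  assumes "\<tau> > 0" "t > 0"
  shows "t \<le> real (nat \<lceil>t / \<tau>\<rceil>) * \<tau>" "real (nat \<lceil>t / \<tau>\<rceil>) * \<tau> < t + \<tau>" "nat \<lceil>t / \<tau>\<rceil> \<ge> 1"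
proof -
  have "t / \<tau> > 0" using assms by simp
  then show "nat \<lceil>t / \<tau>\<rceil> \<ge> 1" by (simp add: Suc_le_eq)
  have "t \<in> {(real (nat \<lceil>t / \<tau>\<rceil>) - 1) * \<tau> <.. real (nat \<lceil>t / \<tau>\<rceil>) * \<tau>}"
    using cell_index_iff[OF assms] by simp
  then show "t \<le> real (nat \<lceil>t / \<tau>\<rceil>) * \<tau>" "real (nat \<lceil>t / \<tau>\<rceil>) * \<tau> < t + \<tau>"
    by (auto simp: algebra_simps)
qed

lemma cell_index_le:
  assumes "\<tau> > 0" "t > 0" "t \<le> real N * \<tau>"
  shows "nat \<lceil>t / \<tau>\<rceil> \<le> N"
proof -
  have "t / \<tau> \<le> real N" using assms by (simp add: field_simps)
  then show ?thesis by (simp add: ceiling_le_iff)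
qed

lemma step_interp_eq:
  assumes "\<tau> > 0" "t > 0" "t \<le> real N * \<tau>"
  shows "step_interp \<tau> N v t = v (nat \<lceil>t / \<tau>\<rceil>)"
proof -
  have "step_interp \<tau> N v t = (\<Sum>j=1..N. if j = nat \<lceil>t / \<tau>\<rceil> then v j else 0)"
    unfolding step_interp_def
    using cell_index_iff[OF assms(1,2)] by (intro sum.cong refl) (simp add: indicator_def)
  also have "\<dots> = v (nat \<lceil>t / \<tau>\<rceil>)"
    using cell_index_le[OF assms] cell_index_bounds(3)[OF assms(1,2)] by (simp add: sum.delta)
  finally show ?thesis .
qed

lemma borel_measurable_step_interp [measurable]: "step_interp \<tau> N v \<in> borel_measurable borel"
  unfolding step_interp_def[abs_def] by measurable

lemma step_interp_lebesgue_measurable: "step_interp \<tau> N v \<in> borel_measurable lebesgue"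
  by (rule measurable_completion) simp

lemma step_interp_0 [simp]: "step_interp \<tau> 0 v = (\<lambda>t. 0)"
  by (simp add: step_interp_def fun_eq_iff)

definition cell_integral :: "(real \<Rightarrow> real) \<Rightarrow> real \<Rightarrow> nat \<Rightarrow> real" where
  "cell_integral h \<tau> k = integral {(real k - 1) * \<tau>..real k * \<tau>} h"

lemma set_integral_step_interp_mult:
  assumes "\<tau> > 0" and h: "set_integrable lebesgue {0<..<real N * \<tau>} h"
  shows "(LINT t:{0<..<real N * \<tau>}|lebesgue. step_interp \<tau> N v t * h t)
      = (\<Sum>j=1..N. v j * cell_integral h \<tau> j)"
proof -
  let ?T = "real N * \<tau>"
  define I where "I j = {(real j - 1) * \<tau><..<real j * \<tau>}" for j
  have sub: "I j \<subseteq> {0<..<?T}" if "j \<in> {1..N}" for j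
  proof -
    have "0 \<le> (real j - 1) * \<tau>" "real j * \<tau> \<le> ?T" using that assms by auto
    then show ?thesis unfolding I_def by fastforce
  qed
  have int: "set_integrable lebesgue (I j) h" if "j \<in> {1..N}" for j
    by (rule set_integrable_subset[OF h _ sub[OF that]]) (simp add: I_def)
  have "(LINT t:{0<..<?T}|lebesgue. step_interp \<tau> N v t * h t)
      = (LINT t|lebesgue. (\<Sum>j=1..N. v j * (indicator (I j) t *\<^sub>R h t)))"
    unfolding set_lebesgue_integral_def
  proof (rule integral_cong_AE)
    have [measurable]: "(\<lambda>t. indicator {0<..<?T} t *\<^sub>R h t) \<in> borel_measurable lebesgue"
      using h by (simp add: set_integrable_def)
    have "(\<lambda>t. step_interp \<tau> N v t * (indicator {0<..<?T} t *\<^sub>R h t)) \<in> borel_measurable lebesgue"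
      by (intro borel_measurable_times step_interp_lebesgue_measurable) measurable
    then show "(\<lambda>t. indicator {0<..<?T} t *\<^sub>R (step_interp \<tau> N v t * h t)) \<in> borel_measurable lebesgue"
      by (simp add: mult_ac)
    show "(\<lambda>t. \<Sum>j=1..N. v j * (indicator (I j) t *\<^sub>R h t)) \<in> borel_measurable lebesgue"
      using int by (intro borel_measurable_sum borel_measurable_times) (auto simp: set_integrable_def)
    have "AE t in lebesgue. t \<notin> (\<lambda>j. real j * \<tau>) ` {..N}"
      by (intro AE_completion finite_imp_null_set_lborel[THEN AE_not_in]) simp
    then show "AE t in lebesgue. indicator {0<..<?T} t *\<^sub>R (step_interp \<tau> N v t * h t)
        = (\<Sum>j=1..N. v j * (indicator (I j) t *\<^sub>R h t))"
    proof eventually_elim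
      case (elim t)
      have "indicator {0<..<?T} t *\<^sub>R (step_interp \<tau> N v t * h t)
        = (\<Sum>j=1..N. v j * (indicator {0<..<?T} t * indicator {(real j - 1) * \<tau> <.. real j * \<tau>} t * h t))"
        unfolding step_interp_def sum_distrib_left sum_distrib_right real_scaleR_def
        by (intro sum.cong refl) (simp only: mult_ac)
      also have "\<dots> = (\<Sum>j=1..N. v j * (indicator (I j) t *\<^sub>R h t))"
      proof (intro sum.cong refl)
        fix j assume j: "j \<in> {1..N}"
        then have "t \<noteq> real j * \<tau>" using elim by auto
        then have "indicator {0<..<?T} t * indicator {(real j - 1) * \<tau> <.. real j * \<tau>} t
            = (indicator (I j) t :: real)"
          using sub[OF j] by (auto simp: I_def indicator_def)
        then show "v j * (indicator {0<..<?T} t * indicator {(real j - 1) * \<tau> <.. real j * \<tau>} t * h t)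
          = v j * (indicator (I j) t *\<^sub>R h t)" by simp
      qed
      finally show ?case .
    qed
  qed
  also have "\<dots> = (\<Sum>j=1..N. v j * (LINT t:I j|lebesgue. h t))"
    using int unfolding set_lebesgue_integral_def set_integrable_def
    by (subst Bochner_Integration.integral_sum) (auto intro!: sum.cong integral_mult_right_zero)
  also have "\<dots> = (\<Sum>j=1..N. v j * cell_integral h \<tau> j)"
    using set_lebesgue_integral_eq_integral(2)[OF int]
    by (intro sum.cong refl) (auto simp: I_def cell_integral_def integral_open_interval_real)
  finally show ?thesis .
qed

lemma set_integral_step_interp:
  assumes "\<tau> > 0"
  shows "(LINT t:{0<..<real N * \<tau>}|lebesgue. step_interp \<tau> N v t) = (\<Sum>j=1..N. \<tau> * v j)"
proof -
  have "set_integrable lebesgue {0<..<real N * \<tau>} (\<lambda>_. 1 :: real)"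
    by (intro continuous_set_integrable_Ioo continuous_intros)
  from set_integral_step_interp_mult[OF assms this, of v]
  show ?thesis using assms by (simp add: cell_integral_def algebra_simps)
qed

lemma mvt_simple_interior:
  fixes f :: "real \<Rightarrow> real"
  assumes "a < b" "continuous_on {a..b} f"
    and "\<And>x. a < x \<Longrightarrow> x < b \<Longrightarrow> (f has_real_derivative f' x) (at x)"
  shows "\<exists>x\<in>{a<..<b}. f b - f a = f' x * (b - a)"
  using mvt[OF assms(1,2), of "\<lambda>x. (*) (f' x)"] assms(3)
  by (metis greaterThanLessThan_iff has_field_derivative_def)

text \<open>
  The primitive of \<open>\<phi>\<close>, to which the mean value theorem is applied below.
\<close>

lemma integral_from_0:
  fixes \<phi> :: "real \<Rightarrow> real"
  assumes "continuous_on {0..T} \<phi>"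
  shows integral_from_0_diff: "\<And>a b. 0 \<le> a \<Longrightarrow> a \<le> b \<Longrightarrow> b \<le> T \<Longrightarrow>
      integral {a..b} \<phi> = integral {0..b} \<phi> - integral {0..a} \<phi>"
    and integral_from_0_deriv: "\<And>x. 0 < x \<Longrightarrow> x < T \<Longrightarrow>
      ((\<lambda>x. integral {0..x} \<phi>) has_real_derivative \<phi> x) (at x)"
    and integral_from_0_cont: "continuous_on {0..T} (\<lambda>x. integral {0..x} \<phi>)"
proof -
  show "integral {a..b} \<phi> = integral {0..b} \<phi> - integral {0..a} \<phi>" if "0 \<le> a" "a \<le> b" "b \<le> T" for a b
  proof -
    have "\<phi> integrable_on {0..b}"
      using that by (intro integrable_continuous_real continuous_on_subset[OF assms]) auto
    from Henstock_Kurzweil_Integration.integral_combine[OF that(1,2) this] show ?thesis by simp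
  qed
  have d: "((\<lambda>x. integral {0..x} \<phi>) has_real_derivative \<phi> x) (at x within {0..T})" if "x \<in> {0..T}" for x
    using integral_has_real_derivative[OF assms that] .
  then show "continuous_on {0..T} (\<lambda>x. integral {0..x} \<phi>)"
    by (rule DERIV_continuous_on)
  show "((\<lambda>x. integral {0..x} \<phi>) has_real_derivative \<phi> x) (at x)" if "0 < x" "x < T" for x
    using d[of x] that at_within_Icc_at[of 0 x T] by simp
qed

text \<open>
  Dividing by \<open>\<tau>\<close>, the averages over the cells are samples of \<open>\<phi>\<close> at points that follow the grid; in
  this form they enter the convergence of discrete Abel integrals.
\<close>

lemma cell_integral_mean_value:
  assumes "\<tau> > 0" "1 \<le> k" "real k * \<tau> \<le> T" and cont: "continuous_on {0..T} \<phi>"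
  shows "\<exists>\<eta>\<in>{0..T}. \<bar>\<eta> - real k * \<tau>\<bar> \<le> \<tau> \<and> cell_integral \<phi> \<tau> k = \<tau> * \<phi> \<eta>"
proof -
  let ?a = "(real k - 1) * \<tau>" and ?P = "\<lambda>x. integral {0..x} \<phi>"
  have a: "0 \<le> ?a" "?a < real k * \<tau>" "real k * \<tau> - ?a = \<tau>" using assms by (auto simp: algebra_simps)
  have "\<exists>\<eta>\<in>{?a<..<real k * \<tau>}. ?P (real k * \<tau>) - ?P ?a = \<phi> \<eta> * (real k * \<tau> - ?a)"
  proof (rule mvt_simple_interior[OF a(2)])
    show "continuous_on {?a..real k * \<tau>} ?P"
      by (rule continuous_on_subset[OF integral_from_0_cont[OF cont]]) (use a assms in auto)
    show "(?P has_real_derivative \<phi> x) (at x)" if "?a < x" "x < real k * \<tau>" for x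
      using that a assms by (intro integral_from_0_deriv[OF cont]) linarith+
  qed
  then obtain \<eta> where eta: "?a < \<eta>" "\<eta> < real k * \<tau>" and eq: "?P (real k * \<tau>) - ?P ?a = \<phi> \<eta> * \<tau>"
    unfolding a(3) by auto
  have "cell_integral \<phi> \<tau> k = \<tau> * \<phi> \<eta>"
    unfolding cell_integral_def using integral_from_0_diff[OF cont, of ?a "real k * \<tau>"] eq a assms by simp
  moreover have "\<bar>\<eta> - real k * \<tau>\<bar> \<le> \<tau>" using eta a by linarith
  moreover have "\<eta> \<in> {0..T}" using order_trans[OF a(1) less_imp_le[OF eta(1)]] eta(2) assms(3) by simp
  ultimately show ?thesis by blast
qed

text \<open>
  Two mean value theorems in a row. The difference of neighbouring cell integrals is the increment
  over one cell of \<open>x \<mapsto> P (x + \<tau>) - P x\<close>, where \<open>P\<close> is a primitive of \<open>\<phi>\<close>, hence \<open>\<tau>\<close> times a value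
  of \<open>\<phi> (x + \<tau>) - \<phi> x\<close>, and this is \<open>\<tau>\<close> times a value of the derivative.
\<close>

lemma cell_integral_diff_mean_value:
  assumes "\<tau> > 0" "1 \<le> k" "real (Suc k) * \<tau> \<le> T"
    and cont: "continuous_on {0..T} \<phi>"
    and deriv: "\<And>x. 0 < x \<Longrightarrow> x < T \<Longrightarrow> (\<phi> has_real_derivative D x) (at x)"
  shows "\<exists>\<eta>\<in>{0..T}. \<bar>\<eta> - real k * \<tau>\<bar> \<le> \<tau>
      \<and> cell_integral \<phi> \<tau> (Suc k) - cell_integral \<phi> \<tau> k = \<tau>\<^sup>2 * D \<eta>"
proof -
  let ?a = "(real k - 1) * \<tau>" and ?b = "real k * \<tau>" and ?P = "\<lambda>x. integral {0..x} \<phi>"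
  let ?Q = "\<lambda>x. ?P (x + \<tau>) - ?P x"
  have a: "0 \<le> ?a" "?a < ?b" "?b - ?a = \<tau>" "?b + \<tau> \<le> T" "?a + \<tau> = ?b"
    using assms by (auto simp: algebra_simps)
  have "\<exists>\<xi>\<in>{?a<..<?b}. ?Q ?b - ?Q ?a = (\<phi> (\<xi> + \<tau>) - \<phi> \<xi>) * (?b - ?a)"
  proof (rule mvt_simple_interior[OF a(2)])
    show "continuous_on {?a..?b} ?Q"
      by (intro continuous_intros continuous_on_compose2[OF integral_from_0_cont[OF cont]])
         (use a assms in auto)
    show "(?Q has_real_derivative (\<phi> (x + \<tau>) - \<phi> x)) (at x)" if "?a < x" "x < ?b" for x
    proof (rule DERIV_diff)
      have "0 < x + \<tau>" "x + \<tau> < T" using that a assms by linarith+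
      from DERIV_shift[THEN iffD1, OF integral_from_0_deriv[OF cont this]]
      show "((\<lambda>x. ?P (x + \<tau>)) has_real_derivative \<phi> (x + \<tau>)) (at x)" by simp
      show "(?P has_real_derivative \<phi> x) (at x)"
        using that a assms by (intro integral_from_0_deriv[OF cont]) linarith+
    qed
  qed
  then obtain \<xi> where xi: "?a < \<xi>" "\<xi> < ?b" and eq: "?Q ?b - ?Q ?a = (\<phi> (\<xi> + \<tau>) - \<phi> \<xi>) * \<tau>"
    unfolding a(3) by auto
  have "\<exists>\<eta>\<in>{\<xi><..<\<xi> + \<tau>}. \<phi> (\<xi> + \<tau>) - \<phi> \<xi> = D \<eta> * (\<xi> + \<tau> - \<xi>)"
  proof (rule mvt_simple_interior)
    show "continuous_on {\<xi>..\<xi> + \<tau>} \<phi>"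
      by (rule continuous_on_subset[OF cont]) (use xi a in auto)
    show "(\<phi> has_real_derivative D x) (at x)" if "\<xi> < x" "x < \<xi> + \<tau>" for x
      using that xi a by (intro deriv) linarith+
  qed (use assms in auto)
  then obtain \<eta> where eta: "\<xi> < \<eta>" "\<eta> < \<xi> + \<tau>" and eq2: "\<phi> (\<xi> + \<tau>) - \<phi> \<xi> = D \<eta> * \<tau>"
    by auto
  have "cell_integral \<phi> \<tau> (Suc k) = ?P (?b + \<tau>) - ?P ?b"
    using integral_from_0_diff[OF cont, of ?b "?b + \<tau>"] a assms by (simp add: cell_integral_def algebra_simps)
  moreover have "cell_integral \<phi> \<tau> k = ?P ?b - ?P ?a"
    using integral_from_0_diff[OF cont, of ?a ?b] a assms by (simp add: cell_integral_def)
  ultimately have "cell_integral \<phi> \<tau> (Suc k) - cell_integral \<phi> \<tau> k = \<tau>\<^sup>2 * D \<eta>"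
    using eq eq2 unfolding a(5) by (simp add: power2_eq_square)
  moreover have "\<bar>\<eta> - ?b\<bar> \<le> \<tau>" using eta xi a by linarith
  ultimately show ?thesis using eta xi a by (intro bexI[of _ \<eta>]) auto
qed

section \<open>Discrete Abel integrals\<close>

text \<open>
  With \<open>q N = S N / w\<close>, which is bounded by \<open>C\<close>, the pairing is \<open>(g N * w) * q N\<close>. Replacing \<open>g N\<close> by \<open>f\<close>
  costs at most \<open>C\<close> times the weighted distance of \<open>g N\<close> and \<open>f\<close>, and for fixed \<open>f\<close> the
  dominated convergence theorem applies.
\<close>

lemma weighted_L1_tendsto_pairing:
  fixes S :: "nat \<Rightarrow> real \<Rightarrow> real"
  assumes conv: "weighted_L1_tendsto a b w g f"
    and w_meas: "w \<in> borel_measurable lebesgue"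
    and w_pos: "\<And>t. a < t \<Longrightarrow> t < b \<Longrightarrow> w t > 0"
    and S_meas: "\<And>N. S N \<in> borel_measurable lebesgue"
    and bound: "\<And>N t. a < t \<Longrightarrow> t < b \<Longrightarrow> \<bar>S N t\<bar> \<le> C * w t"
    and lim: "\<And>t. a < t \<Longrightarrow> t < b \<Longrightarrow> (\<lambda>N. S N t) \<longlonglongrightarrow> s t"
  shows "(\<lambda>N. LINT t:{a<..<b}|lebesgue. g N t * S N t) \<longlonglongrightarrow> (LINT t:{a<..<b}|lebesgue. f t * s t)"
proof -
  define I where "I = (indicator {a<..<b} :: real \<Rightarrow> real)"
  define fw where "fw t = I t * (f t * w t)" for t
  define gw where "gw N t = I t * (g N t * w t)" for N t
  have I: "I t = (if a < t \<and> t < b then 1 else 0)" for t by (simp add: I_def indicator_def)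
  have fw: "integrable lebesgue fw"
    and gw: "\<forall>\<^sub>F N in sequentially. integrable lebesgue (gw N)"
    and dist: "(\<lambda>N. LINT t|lebesgue. \<bar>gw N t - fw t\<bar>) \<longlonglongrightarrow> 0"
  proof -
    have "I t * (\<bar>g N t - f t\<bar> * w t) = \<bar>gw N t - fw t\<bar>" for N t
      using w_pos[of t] by (auto simp: gw_def fw_def I abs_mult left_diff_distrib[symmetric])
    then show "integrable lebesgue fw" "\<forall>\<^sub>F N in sequentially. integrable lebesgue (gw N)"
        "(\<lambda>N. LINT t|lebesgue. \<bar>gw N t - fw t\<bar>) \<longlonglongrightarrow> 0"
      using conv unfolding weighted_L1_tendsto_def set_integrable_def set_lebesgue_integral_def
        fw_def[abs_def] gw_def[abs_def] I_def[symmetric] real_scaleR_def by simp_all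
  qed
  define q where "q N t = S N t / w t" for N t
  have q_meas [measurable]: "q N \<in> borel_measurable lebesgue" for N
    unfolding q_def[abs_def] by (intro borel_measurable_divide S_meas w_meas)
  have fS: "I t * (f t * S N t) = fw t * q N t" and gS: "I t * (g N t * S N t) = gw N t * q N t" for N t
    using w_pos[of t] by (auto simp: fw_def gw_def q_def I)
  have C: "\<bar>x * q N t\<bar> \<le> C * \<bar>x\<bar>" if "x \<noteq> 0 \<Longrightarrow> I t \<noteq> 0" for x N t
  proof (cases "x = 0")
    case False
    then have "a < t" "t < b" using that by (auto simp: I split: if_splits)
    then have "\<bar>q N t\<bar> \<le> C" using bound[of t N] w_pos[of t]
      by (simp add: q_def abs_divide pos_divide_le_eq)
    then show ?thesis using mult_right_mono[of "\<bar>q N t\<bar>" C "\<bar>x\<bar>"]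
      by (simp add: abs_mult mult.commute)
  qed simp
  have meas_f: "(\<lambda>t. fw t * q N t) \<in> borel_measurable lebesgue" for N
    using fw by measurable
  have pointwise: "(\<lambda>N. fw t * q N t) \<longlonglongrightarrow> I t * (f t * s t)" for t
  proof -
    have "(\<lambda>N. I t * (f t * S N t)) \<longlonglongrightarrow> I t * (f t * s t)"
      by (cases "a < t \<and> t < b") (auto simp: I intro!: tendsto_intros lim)
    then show ?thesis by (simp add: fS)
  qed
  have meas_lim: "(\<lambda>t. I t * (f t * s t)) \<in> borel_measurable lebesgue"
    by (rule borel_measurable_LIMSEQ_real[OF pointwise meas_f])
  have dom: "integrable lebesgue (\<lambda>t. C * \<bar>fw t\<bar>)" using fw by simp
  have bnd: "\<And>N. AE t in lebesgue. norm (fw t * q N t) \<le> C * \<bar>fw t\<bar>"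
    by (intro AE_I2) (auto intro!: C simp: fw_def)
  have AE_lim: "AE t in lebesgue. (\<lambda>N. fw t * q N t) \<longlonglongrightarrow> I t * (f t * s t)"
    using pointwise by simp
  have f_lim: "(\<lambda>N. LINT t|lebesgue. fw t * q N t) \<longlonglongrightarrow> (LINT t|lebesgue. I t * (f t * s t))"
    by (rule integral_dominated_convergence[OF meas_lim meas_f dom AE_lim bnd])
  have "(\<lambda>N. (LINT t|lebesgue. gw N t * q N t) - (LINT t|lebesgue. fw t * q N t)) \<longlonglongrightarrow> 0"
  proof (rule Lim_null_comparison)
    show "\<forall>\<^sub>F N in sequentially. norm ((LINT t|lebesgue. gw N t * q N t) - (LINT t|lebesgue. fw t * q N t))
        \<le> C * (LINT t|lebesgue. \<bar>gw N t - fw t\<bar>)"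
      using gw
    proof eventually_elim
      case (elim N)
      have int: "integrable lebesgue (\<lambda>t. h t * q N t)" if "integrable lebesgue h" "\<And>t. h t \<noteq> 0 \<Longrightarrow> I t \<noteq> 0" for h
      proof (rule Bochner_Integration.integrable_bound)
        show "integrable lebesgue (\<lambda>t. C * \<bar>h t\<bar>)" using that by simp
        show "(\<lambda>t. h t * q N t) \<in> borel_measurable lebesgue" using that by measurable
        show "AE t in lebesgue. norm (h t * q N t) \<le> norm (C * \<bar>h t\<bar>)"
        proof (intro AE_I2)
          fix t
          have "\<bar>h t * q N t\<bar> \<le> \<bar>C * \<bar>h t\<bar>\<bar>"
            by (rule order_trans[OF C abs_ge_self]) (rule that(2))
          then show "norm (h t * q N t) \<le> norm (C * \<bar>h t\<bar>)" by simp
        qed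
      qed
      have "norm ((LINT t|lebesgue. gw N t * q N t) - (LINT t|lebesgue. fw t * q N t))
          = norm (LINT t|lebesgue. (gw N t - fw t) * q N t)"
        using int[OF elim] int[OF fw]
        by (subst Bochner_Integration.integral_diff[symmetric]) (auto simp: gw_def fw_def left_diff_distrib)
      also have "\<dots> \<le> (LINT t|lebesgue. norm ((gw N t - fw t) * q N t))"
        by (rule integral_norm_bound)
      also have "\<dots> \<le> (LINT t|lebesgue. C * \<bar>gw N t - fw t\<bar>)"
      proof (rule integral_mono)
        have diff: "integrable lebesgue (\<lambda>t. gw N t - fw t)" using elim fw by simp
        then show "integrable lebesgue (\<lambda>t. C * \<bar>gw N t - fw t\<bar>)" by simp
        have "integrable lebesgue (\<lambda>t. (gw N t - fw t) * q N t)"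
          by (rule int[OF diff]) (auto simp: gw_def fw_def)
        then show "integrable lebesgue (\<lambda>t. norm ((gw N t - fw t) * q N t))" by simp
        show "norm ((gw N t - fw t) * q N t) \<le> C * \<bar>gw N t - fw t\<bar>" for t
          unfolding real_norm_def by (rule C) (auto simp: gw_def fw_def)
      qed
      finally show ?case by simp
    qed
    show "(\<lambda>N. C * (LINT t|lebesgue. \<bar>gw N t - fw t\<bar>)) \<longlonglongrightarrow> 0"
      using tendsto_mult_right_zero[OF dist] by simp
  qed
  from tendsto_add[OF this f_lim]
  have "(\<lambda>N. LINT t|lebesgue. gw N t * q N t) \<longlonglongrightarrow> (LINT t|lebesgue. I t * (f t * s t))" by simp
  then show "(\<lambda>N. LINT t:{a<..<b}|lebesgue. g N t * S N t) \<longlonglongrightarrow> (LINT t:{a<..<b}|lebesgue. f t * s t)"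
    unfolding set_lebesgue_integral_def real_scaleR_def I_def[symmetric] gS .
qed

text \<open>
  The Riemann sum, on the grid of width \<open>\<tau>\<close> and from the node \<open>i\<close> on, of the integral of \<open>\<psi>\<close> against the
  kernel \<open>s powr (- \<alpha>) / (Gamma \<alpha> * Gamma (1 - \<alpha>))\<close>, whose rescaled discrete version is
  \<open>\<tau> powr (- \<alpha>) * caputo_weight \<alpha> m\<close>.
\<close>

definition discrete_abel :: "real \<Rightarrow> real \<Rightarrow> (nat \<Rightarrow> real) \<Rightarrow> nat \<Rightarrow> nat \<Rightarrow> real" where
  "discrete_abel \<alpha> \<tau> \<psi> i n = (\<Sum>m=1..n. \<tau> powr (1 - \<alpha>) * caputo_weight \<alpha> m * \<psi> (i + m))"

lemma scaled_weight_le: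
  assumes "0 < \<alpha>" "\<alpha> < 1" "\<tau> > 0" "u > 0" "u \<le> real m * \<tau>"
  shows "\<tau> powr (- \<alpha>) * caputo_weight \<alpha> m \<le> 1 / u powr \<alpha>"
proof -
  have "\<tau> powr (- \<alpha>) * caputo_weight \<alpha> m \<le> \<tau> powr (- \<alpha>) * real m powr (- \<alpha>)"
    using caputo_weight_le[OF assms(1,2)] by (intro mult_left_mono) auto
  also have "\<dots> = (real m * \<tau>) powr (- \<alpha>)"
    by (simp add: powr_mult)
  also have "\<dots> \<le> u powr (- \<alpha>)" using assms by (intro powr_mono2') auto
  finally show ?thesis by (simp add: powr_minus_divide)
qed

lemma discrete_abel_bound:
  assumes "0 < \<alpha>" "\<alpha> < 1" "\<tau> > 0" "real n * \<tau> \<le> T" and M: "\<And>k. \<bar>\<psi> k\<bar> \<le> M"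
  shows "\<bar>discrete_abel \<alpha> \<tau> \<psi> i n\<bar> \<le> M * T powr (1 - \<alpha>)"
proof -
  have M0: "M \<ge> 0" using M[of 0] by simp
  have sum_le: "(\<Sum>m=1..n. caputo_weight \<alpha> m) \<le> real n powr (1 - \<alpha>)"
  proof (cases n)
    case (Suc k)
    have "(\<Sum>m=1..n. caputo_weight \<alpha> m) = (\<Sum>i\<le>k. caputo_weight \<alpha> (Suc i))"
      unfolding Suc One_nat_def sum.atLeast_Suc_atMost_Suc_shift atMost_atLeast0 comp_def ..
    then show ?thesis using sum_caputo_weight_le[OF assms(1,2), of k] Suc by (simp add: weight_fps_def)
  qed simp
  have "\<bar>discrete_abel \<alpha> \<tau> \<psi> i n\<bar> \<le> (\<Sum>m=1..n. \<tau> powr (1 - \<alpha>) * caputo_weight \<alpha> m * M)"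
    unfolding discrete_abel_def using M caputo_weight_nonneg[OF assms(1,2)]
    by (intro order_trans[OF sum_abs] sum_mono) (auto simp: abs_mult intro!: mult_left_mono)
  also have "\<dots> = M * (\<tau> powr (1 - \<alpha>) * (\<Sum>m=1..n. caputo_weight \<alpha> m))"
    by (simp add: sum_distrib_left sum_distrib_right mult_ac)
  also have "\<dots> \<le> M * (\<tau> powr (1 - \<alpha>) * real n powr (1 - \<alpha>))"
    using sum_le M0 by (intro mult_left_mono) auto
  also have "\<tau> powr (1 - \<alpha>) * real n powr (1 - \<alpha>) = (real n * \<tau>) powr (1 - \<alpha>)"
    by (simp add: powr_mult)
  also have "M * \<dots> \<le> M * T powr (1 - \<alpha>)"
    using assms M0 by (intro mult_left_mono powr_mono2) auto
  finally show ?thesis .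
qed

lemma scaled_index_at_top:
  assumes "T > 0" "u > 0" "(\<lambda>N. real (k N) * (T / real N)) \<longlonglongrightarrow> u"
  shows "filterlim k sequentially sequentially"
proof -
  have "filterlim (\<lambda>N. real (k N) * (T / real N) * (real N / T)) at_top sequentially"
    using assms by (intro filterlim_tendsto_pos_mult_at_top[OF assms(3,2)]) real_asymp
  moreover have "\<forall>\<^sub>F N in sequentially. real (k N) * (T / real N) * (real N / T) = real (k N)"
    using eventually_gt_at_top[of 0] by eventually_elim (use assms in simp)
  ultimately have "filterlim (\<lambda>N. real (k N)) at_top sequentially"
    by (simp add: filterlim_cong)
  then show ?thesis by (simp add: filterlim_sequentially_iff_filterlim_real)
qed

lemma cell_index_tendsto:
  assumes "T > 0" "u > 0"
  shows "(\<lambda>N. real (nat \<lceil>u / (T / real N)\<rceil>) * (T / real N)) \<longlonglongrightarrow> u"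
proof (rule tendsto_sandwich)
  have b: "u \<le> real (nat \<lceil>u / (T / real N)\<rceil>) * (T / real N)"
    "real (nat \<lceil>u / (T / real N)\<rceil>) * (T / real N) < u + T / real N" if "N > 0" for N
    using cell_index_bounds[of "T / real N" u] that assms by auto
  show "\<forall>\<^sub>F N in sequentially. u \<le> real (nat \<lceil>u / (T / real N)\<rceil>) * (T / real N)"
    using eventually_gt_at_top[of 0] by eventually_elim (rule b(1))
  show "\<forall>\<^sub>F N in sequentially. real (nat \<lceil>u / (T / real N)\<rceil>) * (T / real N) \<le> u + T / real N"
    using eventually_gt_at_top[of 0] by eventually_elim (rule less_imp_le[OF b(2)])
  show "(\<lambda>N. u + T / real N) \<longlonglongrightarrow> u" by real_asymp
qed (rule tendsto_const)

lemma scaled_weight_tendsto: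
  assumes "0 < \<alpha>" "\<alpha> < 1" "T > 0" "u > 0"
    and k: "(\<lambda>N. real (k N) * (T / real N)) \<longlonglongrightarrow> u"
  shows "(\<lambda>N. (T / real N) powr (- \<alpha>) * caputo_weight \<alpha> (k N))
    \<longlonglongrightarrow> 1 / (Gamma \<alpha> * Gamma (1 - \<alpha>)) * (1 / u powr \<alpha>)"
proof -
  have k_top: "filterlim k sequentially sequentially"
    by (rule scaled_index_at_top[OF assms(3,4) k])
  have "(\<lambda>N. (caputo_weight \<alpha> (k N) * real (k N) powr \<alpha>) * (1 / (real (k N) * (T / real N)) powr \<alpha>))
      \<longlonglongrightarrow> 1 / (Gamma \<alpha> * Gamma (1 - \<alpha>)) * (1 / u powr \<alpha>)"
    using assms by (intro tendsto_mult filterlim_compose[OF caputo_weight_asymp k_top] tendsto_divide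
        tendsto_const tendsto_powr) auto
  moreover have "\<forall>\<^sub>F N in sequentially.
      (caputo_weight \<alpha> (k N) * real (k N) powr \<alpha>) * (1 / (real (k N) * (T / real N)) powr \<alpha>)
      = (T / real N) powr (- \<alpha>) * caputo_weight \<alpha> (k N)"
    using filterlim_at_top[THEN iffD1, OF k_top, rule_format, of 1] eventually_gt_at_top[of 0]
  proof eventually_elim
    case (elim N)
    have "(real (k N) * (T / real N)) powr \<alpha> = real (k N) powr \<alpha> * (T / real N) powr \<alpha>"
      by (rule powr_mult)
    then show ?case using elim assms by (simp add: powr_minus_divide)
  qed
  ultimately show ?thesis by (rule Lim_transform_eventually)
qed

text \<open>
  The sum over \<open>m\<close> is the integral over \<open>u\<close> of the step function with values
  \<open>\<tau> powr (- \<alpha>) * caputo_weight \<alpha> m * \<psi> N (i N + m)\<close>. At a fixed \<open>u\<close> the index is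
  \<open>m = \<lceil>u / \<tau>\<rceil>\<close>, so the asymptotics of the weights and the continuity of \<open>D\<close> give the limit
  \<open>D (t + u) / u powr \<alpha>\<close> up to the constant; the bound \<open>1 / u powr \<alpha>\<close> on the rescaled weights
  dominates. The point \<open>u = T - t\<close>, where the sum is cut off, has measure zero.
  Samples of \<open>D\<close> are taken at the inner nodes only, because a node that stays near an interior
  point is eventually neither 0 nor \<open>N\<close>.
\<close>

lemma discrete_abel_tendsto:
  fixes D :: "real \<Rightarrow> real"
  assumes alpha: "0 < \<alpha>" "\<alpha> < 1" and T: "T > 0" and t: "0 \<le> t" "t < T"
    and i: "(\<lambda>N. real (i N) * (T / real N)) \<longlonglongrightarrow> t"
    and cont: "continuous_on {0..T} D"
    and sample: "\<And>N k. 1 \<le> k \<Longrightarrow> k < N \<Longrightarrow>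
      \<exists>\<eta>\<in>{0..T}. \<bar>\<eta> - real k * (T / real N)\<bar> \<le> T / real N \<and> \<psi> N k = D \<eta>"
    and M: "\<And>N k. \<bar>\<psi> N k\<bar> \<le> M"
  shows "(\<lambda>N. discrete_abel \<alpha> (T / real N) (\<psi> N) (i N) (N - i N))
    \<longlonglongrightarrow> 1 / (Gamma \<alpha> * Gamma (1 - \<alpha>)) * (LINT s:{t<..<T}|lebesgue. D s / (s - t) powr \<alpha>)"
proof -
  define c where "c = 1 / (Gamma \<alpha> * Gamma (1 - \<alpha>))"
  define \<tau> where "\<tau> N = T / real N" for N
  define v where "v N m = (if m \<le> N - i N then \<tau> N powr (- \<alpha>) * caputo_weight \<alpha> m * \<psi> N (i N + m) else 0)" for N m
  define G where "G u = indicator {0<..<T - t} u * (c * (D (u + t) / (u + t - t) powr \<alpha>))" for u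
  have M0: "M \<ge> 0" using M[of 0 0] by simp
  have tau0: "\<tau> \<longlonglongrightarrow> 0" unfolding \<tau>_def by real_asymp
  have tau_pos: "\<tau> N > 0" if "N > 0" for N using T that by (simp add: \<tau>_def)
  have N_tau: "real N * \<tau> N = T" if "N > 0" for N using that by (simp add: \<tau>_def)
  have "(LINT u:{0<..<T}|lebesgue. step_interp (\<tau> N) N (v N) u)
      = discrete_abel \<alpha> (\<tau> N) (\<psi> N) (i N) (N - i N)" if "N > 0" for N
  proof -
    have "(LINT u:{0<..<T}|lebesgue. step_interp (\<tau> N) N (v N) u) = (\<Sum>m=1..N. \<tau> N * v N m)"
      using set_integral_step_interp[OF tau_pos[OF that], of N "v N"] N_tau[OF that] by simp
    also have "\<dots> = (\<Sum>m=1..N - i N. \<tau> N * v N m)"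
      by (rule sum.mono_neutral_right) (auto simp: v_def)
    also have "\<dots> = discrete_abel \<alpha> (\<tau> N) (\<psi> N) (i N) (N - i N)"
      unfolding discrete_abel_def using tau_pos[OF that]
      by (intro sum.cong refl) (simp add: v_def powr_diff powr_minus_divide)
    finally show ?thesis .
  qed
  then have eq: "\<forall>\<^sub>F N in sequentially. (LINT u:{0<..<T}|lebesgue. step_interp (\<tau> N) N (v N) u)
      = discrete_abel \<alpha> (\<tau> N) (\<psi> N) (i N) (N - i N)"
    by (intro eventually_mono[OF eventually_gt_at_top[of 0]])
  have pointwise: "(\<lambda>N. step_interp (\<tau> N) N (v N) u) \<longlonglongrightarrow> G u" if u: "0 < u" "u < T" "u \<noteq> T - t" for u
  proof -
    define k where "k N = nat \<lceil>u / \<tau> N\<rceil>" for N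
    have k_tau: "(\<lambda>N. real (k N) * \<tau> N) \<longlonglongrightarrow> u"
      using cell_index_tendsto[OF T u(1)] by (simp add: k_def \<tau>_def)
    have k_top: "filterlim k sequentially sequentially"
      by (rule scaled_index_at_top[OF T u(1)]) (use k_tau in \<open>simp add: \<tau>_def\<close>)
    have step: "\<forall>\<^sub>F N in sequentially. v N (k N) = step_interp (\<tau> N) N (v N) u"
      using eventually_gt_at_top[of 0]
    proof eventually_elim
      case (elim N)
      then show ?case using step_interp_eq[OF tau_pos u(1), of N N "v N"] N_tau u by (simp add: k_def)
    qed
    have ik: "(\<lambda>N. real (i N + k N) * \<tau> N) \<longlonglongrightarrow> t + u"
      using tendsto_add[OF i k_tau] by (simp add: \<tau>_def distrib_right add_divide_distrib)
    have "(\<lambda>N. v N (k N)) \<longlonglongrightarrow> G u"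
    proof (cases "u < T - t")
      case True
      have "t + u < T" using True by simp
      from order_tendstoD(2)[OF ik this] eventually_gt_at_top[of 0]
        filterlim_at_top[THEN iffD1, OF k_top, rule_format, of 1]
      have ev: "\<forall>\<^sub>F N in sequentially. 1 \<le> i N + k N \<and> i N + k N < N"
      proof eventually_elim
        case (elim N)
        then have "real (i N + k N) * \<tau> N < real N * \<tau> N" using N_tau by simp
        then show ?case using tau_pos[of N] elim by (simp add: mult_less_cancel_right)
      qed
      define \<eta> where "\<eta> N = (SOME \<eta>. \<eta> \<in> {0..T} \<and> \<bar>\<eta> - real (i N + k N) * \<tau> N\<bar> \<le> \<tau> N
          \<and> \<psi> N (i N + k N) = D \<eta>)" for N
      have eta: "\<forall>\<^sub>F N in sequentially. \<eta> N \<in> {0..T} \<and> \<bar>\<eta> N - real (i N + k N) * \<tau> N\<bar> \<le> \<tau> N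
          \<and> \<psi> N (i N + k N) = D (\<eta> N)"
        using ev
      proof eventually_elim
        case (elim N)
        then have "\<exists>\<eta>. \<eta> \<in> {0..T} \<and> \<bar>\<eta> - real (i N + k N) * \<tau> N\<bar> \<le> \<tau> N \<and> \<psi> N (i N + k N) = D \<eta>"
          using sample[of "i N + k N" N] by (auto simp: \<tau>_def)
        from someI_ex[OF this] show ?case unfolding \<eta>_def .
      qed
      have "(\<lambda>N. \<eta> N - real (i N + k N) * \<tau> N) \<longlonglongrightarrow> 0"
        by (rule Lim_null_comparison[OF _ tau0]) (use eta in \<open>eventually_elim, simp\<close>)
      from tendsto_add[OF this ik] have "\<eta> \<longlonglongrightarrow> t + u" by simp
      moreover have "\<forall>\<^sub>F N in sequentially. \<eta> N \<in> {0..T}" using eta by eventually_elim simp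
      ultimately have "(\<lambda>N. D (\<eta> N)) \<longlonglongrightarrow> D (t + u)"
        using True u t by (intro continuous_on_tendsto_compose[OF cont]) auto
      then have psi: "(\<lambda>N. \<psi> N (i N + k N)) \<longlonglongrightarrow> D (t + u)"
        by (rule Lim_transform_eventually) (use eta in \<open>eventually_elim, simp\<close>)
      have "(\<lambda>N. \<tau> N powr (- \<alpha>) * caputo_weight \<alpha> (k N) * \<psi> N (i N + k N)) \<longlonglongrightarrow> c * (1 / u powr \<alpha>) * D (t + u)"
        using tendsto_mult[OF scaled_weight_tendsto[OF alpha T u(1) k_tau[unfolded \<tau>_def]] psi]
        unfolding c_def \<tau>_def .
      then have "(\<lambda>N. v N (k N)) \<longlonglongrightarrow> c * (1 / u powr \<alpha>) * D (t + u)"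
      proof (rule Lim_transform_eventually)
        show "\<forall>\<^sub>F N in sequentially.
            \<tau> N powr (- \<alpha>) * caputo_weight \<alpha> (k N) * \<psi> N (i N + k N) = v N (k N)"
          using ev
        proof eventually_elim
          case (elim N)
          then have "k N \<le> N - i N" by linarith
          then show ?case by (simp add: v_def)
        qed
      qed
      then show ?thesis using True u by (simp add: G_def add.commute)
    next
      case False
      then have "T < t + u" using u by simp
      from order_tendstoD(1)[OF ik this] eventually_gt_at_top[of 0]
        filterlim_at_top[THEN iffD1, OF k_top, rule_format, of 1]
      have "\<forall>\<^sub>F N in sequentially. 0 = v N (k N)"
      proof eventually_elim
        case (elim N)
        then have "real N * \<tau> N < real (i N + k N) * \<tau> N" using N_tau by simp
        then have "N < i N + k N" using tau_pos[of N] elim by (simp add: mult_less_cancel_right)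
        then have "\<not> k N \<le> N - i N" using elim by linarith
        then show ?case by (simp add: v_def)
      qed
      from Lim_transform_eventually[OF tendsto_const this] show ?thesis
        using False by (simp add: G_def)
    qed
    from Lim_transform_eventually[OF this step] show ?thesis .
  qed
  have bound: "\<bar>step_interp (\<tau> N) N (v N) u\<bar> \<le> M * (1 / u powr \<alpha>)" if u: "0 < u" "u < T" for u N
  proof (cases "N = 0")
    case False
    let ?k = "nat \<lceil>u / \<tau> N\<rceil>"
    have "\<bar>v N ?k\<bar> \<le> \<tau> N powr (- \<alpha>) * caputo_weight \<alpha> ?k * M"
      using M M0 caputo_weight_nonneg[OF alpha] by (auto simp: v_def abs_mult intro!: mult_left_mono)
    also have "\<dots> \<le> 1 / u powr \<alpha> * M"
      using scaled_weight_le[OF alpha tau_pos u(1)] cell_index_bounds(1)[OF tau_pos u(1)] False M0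
      by (intro mult_right_mono) auto
    finally show ?thesis
      using step_interp_eq[OF tau_pos u(1), of N N "v N"] N_tau[of N] False u by (simp add: mult.commute)
  qed (use M0 in simp)
  have "(\<lambda>N. LINT u|lebesgue. indicator {0<..<T} u *\<^sub>R step_interp (\<tau> N) N (v N) u) \<longlonglongrightarrow> (LINT u|lebesgue. G u)"
  proof (rule integral_dominated_convergence)
    have "set_integrable lebesgue {0<..<T} (\<lambda>u. 1 / (u - 0) powr \<alpha>)"
      using alpha T by (intro set_integrable_powr_left) auto
    then have "set_integrable lebesgue {0<..<T} (\<lambda>u. M * (1 / u powr \<alpha>))"
      by (intro set_integrable_mult_right) simp
    then show "integrable lebesgue (\<lambda>u. indicator {0<..<T} u *\<^sub>R (M * (1 / u powr \<alpha>)))"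
      by (simp add: set_integrable_def)
    show "AE u in lebesgue. norm (indicator {0<..<T} u *\<^sub>R step_interp (\<tau> N) N (v N) u)
        \<le> indicator {0<..<T} u *\<^sub>R (M * (1 / u powr \<alpha>))" for N
      using bound by (intro AE_I2) (auto simp: indicator_def)
    show "(\<lambda>u. indicator {0<..<T} u *\<^sub>R step_interp (\<tau> N) N (v N) u) \<in> borel_measurable lebesgue" for N
      by (intro measurable_completion) simp
    have "AE u in lebesgue. u \<notin> {T - t}"
      by (intro AE_completion finite_imp_null_set_lborel[THEN AE_not_in]) simp
    then show "AE u in lebesgue. (\<lambda>N. indicator {0<..<T} u *\<^sub>R step_interp (\<tau> N) N (v N) u) \<longlonglongrightarrow> G u"
    proof eventually_elim
      case (elim u)
      show ?case
      proof (cases "0 < u \<and> u < T")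
        case True
        then show ?thesis using pointwise[of u] elim by simp
      next
        case False
        then have "G u = 0" using t by (auto simp: G_def)
        then show ?thesis using False by (auto simp: indicator_def)
      qed
    qed
    have "set_borel_measurable lebesgue {0<..<T - t} (\<lambda>u. c * (D (u + t) / (u + t - t) powr \<alpha>))"
    proof -
      have "continuous_on {0<..<T - t} (\<lambda>u. c * (D (u + t) / (u + t - t) powr \<alpha>))"
        by (intro continuous_intros continuous_on_compose2[OF cont]) (use t in auto)
      from borel_measurable_continuous_on_indicator[OF _ this]
      show ?thesis unfolding set_borel_measurable_def by (intro measurable_completion) simp
    qed
    then show "G \<in> borel_measurable lebesgue"
      unfolding set_borel_measurable_def G_def[abs_def] by simp
  qed
  then have lim: "(\<lambda>N. LINT u:{0<..<T}|lebesgue. step_interp (\<tau> N) N (v N) u) \<longlonglongrightarrow> (LINT u|lebesgue. G u)"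
    by (simp add: set_lebesgue_integral_def)
  have "(LINT u|lebesgue. G u) = (LINT u:{0<..<T - t}|lebesgue. c * (D (u + t) / (u + t - t) powr \<alpha>))"
    by (simp add: G_def set_lebesgue_integral_def)
  also have "\<dots> = (LINT s:{t<..<T}|lebesgue. c * (D s / (s - t) powr \<alpha>))"
    using set_integral_shift[of 0 "T - t" "\<lambda>s. c * (D s / (s - t) powr \<alpha>)" t] by simp
  also have "\<dots> = c * (LINT s:{t<..<T}|lebesgue. D s / (s - t) powr \<alpha>)"
    by (rule set_integral_mult_right)
  finally show ?thesis
    using Lim_transform_eventually[OF lim eq] by (simp add: c_def \<tau>_def)
qed

section \<open>Convergence of the paired discrete derivative\<close>

text \<open>
  Moving both differences off \<open>f\<close>: first onto the weights \<open>l\<close>, where \<open>l 0 = 0\<close> lets the sums be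
  extended to the diagonal, then onto the test values \<open>c\<close>. This leaves one boundary term for the
  last cell and one for the initial value.
\<close>

lemma discrete_caputo_summation_by_parts:
  fixes l f c :: "nat \<Rightarrow> real"
  assumes "l 0 = 0"
  shows "(\<Sum>k=1..N. (\<Sum>j<k. l (k - j) * (f (j + 1) - f j)) * c k)
    = c N * (\<Sum>i<N. f (Suc i) * l (N - i))
      - (\<Sum>i<N. f (Suc i) * (\<Sum>m=1..N - Suc i. l m * (c (Suc (i + m)) - c (i + m))))
      - f 0 * (\<Sum>k=1..N. l k * c k)"
proof (induction N)
  case (Suc N)
  have inner: "(\<Sum>m=1..N - i. l m * (c (Suc (i + m)) - c (i + m)))
      = (\<Sum>m=1..N - Suc i. l m * (c (Suc (i + m)) - c (i + m))) + l (N - i) * (c (Suc N) - c N)"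
    if "i < N" for i
  proof -
    have "\<exists>d. N = Suc (i + d)" using that by (simp add: less_iff_Suc_add)
    then obtain d where "N = Suc (i + d)" ..
    then show ?thesis by simp
  qed
  have e1: "(\<Sum>i<Suc N. f (Suc i) * (\<Sum>m=1..Suc N - Suc i. l m * (c (Suc (i + m)) - c (i + m))))
      = (\<Sum>i<N. f (Suc i) * (\<Sum>m=1..N - Suc i. l m * (c (Suc (i + m)) - c (i + m))))
        + (\<Sum>i<N. f (Suc i) * l (N - i)) * (c (Suc N) - c N)"
  proof -
    have "(\<Sum>i<Suc N. f (Suc i) * (\<Sum>m=1..Suc N - Suc i. l m * (c (Suc (i + m)) - c (i + m))))
        = (\<Sum>i<N. f (Suc i) * (\<Sum>m=1..N - i. l m * (c (Suc (i + m)) - c (i + m))))" by simp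
    also have "\<dots> = (\<Sum>i<N. f (Suc i) * (\<Sum>m=1..N - Suc i. l m * (c (Suc (i + m)) - c (i + m)))
        + f (Suc i) * l (N - i) * (c (Suc N) - c N))"
      by (intro sum.cong refl) (subst inner, auto simp: distrib_left)
    finally show ?thesis unfolding sum.distrib sum_distrib_right .
  qed
  have e2: "(\<Sum>j<Suc N. l (Suc N - j) * (f (j + 1) - f j))
      = (\<Sum>i<Suc N. f (Suc i) * l (Suc N - i)) - (\<Sum>i<N. f (Suc i) * l (N - i)) - f 0 * l (Suc N)"
  proof -
    have "(\<Sum>j<Suc N. l (Suc N - j) * f j) = l (Suc N) * f 0 + (\<Sum>i<N. l (N - i) * f (Suc i))"
      by (subst sum.lessThan_Suc_shift) simp
    then show ?thesis by (simp add: right_diff_distrib sum_subtractf mult_ac)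
  qed
  have e3: "(\<Sum>k=1..Suc N. (\<Sum>j<k. l (k - j) * (f (j + 1) - f j)) * c k)
      = (\<Sum>k=1..N. (\<Sum>j<k. l (k - j) * (f (j + 1) - f j)) * c k)
        + (\<Sum>j<Suc N. l (Suc N - j) * (f (j + 1) - f j)) * c (Suc N)"
    and e4: "(\<Sum>k=1..Suc N. l k * c k) = (\<Sum>k=1..N. l k * c k) + l (Suc N) * c (Suc N)"
    by simp_all
  show ?case unfolding e1 e3 e4 e2 Suc.IH by (simp only: algebra_simps)
qed simp

text \<open>
  The three terms are the boundary term of the last cell, the discrete counterpart of the right
  Caputo derivative of \<open>\<phi>\<close>, and the contribution of the initial value. The
  sequences \<open>\<psi>\<close> and \<open>\<phi>'\<close> are the second and first difference quotients of a primitive of \<open>\<phi>\<close>; they are set to 0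
  where the cells in question would leave the interval. The added node \<open>N\<close> in the second term is
  one of those, so it does not change the sum.
\<close>

lemma step_caputo_pairing:
  fixes F :: "nat \<Rightarrow> real" and \<phi> :: "real \<Rightarrow> real"
  assumes "N \<ge> 1" "0 < T" and alpha: "0 < \<alpha>" "\<alpha> < 1" and cont: "continuous_on {0..T} \<phi>"
  defines "\<tau> \<equiv> T / real N" and "c \<equiv> cell_integral \<phi> (T / real N)"
  defines "\<psi> \<equiv> (\<lambda>k. if 1 \<le> k \<and> k < N then (c (Suc k) - c k) / \<tau>\<^sup>2 else 0)"
    and "\<phi>' \<equiv> (\<lambda>k. if 1 \<le> k \<and> k \<le> N then c k / \<tau> else 0)"
  shows "(LINT t:{0<..<T}|lebesgue. step_caputo \<alpha> \<tau> N F t * \<phi> t)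
    = Gamma \<alpha> * ((LINT t:{0<..<T}|lebesgue. step_interp \<tau> N F t
          * step_interp \<tau> N (\<lambda>j. \<tau> powr (- \<alpha>) * caputo_weight \<alpha> (N - (j - 1)) * (c N / \<tau>)) t)
        - (LINT t:{0<..<T}|lebesgue. step_interp \<tau> N F t
          * step_interp \<tau> N (\<lambda>j. discrete_abel \<alpha> \<tau> \<psi> (j - 1) (N - (j - 1))) t)
        - F 0 * discrete_abel \<alpha> \<tau> \<phi>' 0 N)"
proof -
  have tau: "\<tau> > 0" and N_tau: "real N * \<tau> = T" using assms by (auto simp: \<tau>_def)
  have c_eq: "c = cell_integral \<phi> \<tau>" by (simp add: c_def \<tau>_def)
  let ?l = "caputo_weight \<alpha>"
  let ?p = "\<tau> powr (- \<alpha>)"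
  have p: "\<tau> powr (1 - \<alpha>) = ?p * \<tau>" using tau by (simp add: powr_diff powr_minus_divide)
  have prod: "(LINT t:{0<..<T}|lebesgue. step_interp \<tau> N F t * step_interp \<tau> N v t)
      = (\<Sum>i<N. \<tau> * (F (Suc i) * v (Suc i)))" for v
  proof -
    have "(LINT t:{0<..<T}|lebesgue. step_interp \<tau> N F t * step_interp \<tau> N v t)
        = (LINT t:{0<..<T}|lebesgue. step_interp \<tau> N (\<lambda>j. F j * v j) t)"
      by (rule set_lebesgue_integral_cong) (auto simp: step_interp_eq[OF tau] N_tau)
    also have "\<dots> = (\<Sum>j=1..N. \<tau> * (F j * v j))"
      using set_integral_step_interp[OF tau, of N] unfolding N_tau by simp
    also have "\<dots> = (\<Sum>i<N. \<tau> * (F (Suc i) * v (Suc i)))"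
      by (rule sum.reindex_bij_witness[of _ Suc "\<lambda>j. j - 1"]) auto
    finally show ?thesis .
  qed
  have bdry: "(\<Sum>i<N. \<tau> * (F (Suc i) * (?p * ?l (N - (Suc i - 1)) * (c N / \<tau>))))
      = ?p * (c N * (\<Sum>i<N. F (Suc i) * ?l (N - i)))"
    unfolding sum_distrib_left using tau by (intro sum.cong refl) simp
  \<comment> \<open>The powers of \<open>\<tau>\<close> match because \<open>\<tau> * \<tau> powr (1 - \<alpha>) / \<tau>\<^sup>2 = \<tau> powr (- \<alpha>)\<close>.\<close>
  have inner: "\<tau> * discrete_abel \<alpha> \<tau> \<psi> i (N - i)
      = ?p * (\<Sum>m=1..N - Suc i. ?l m * (c (Suc (i + m)) - c (i + m)))" if "i < N" for i
  proof -
    have "discrete_abel \<alpha> \<tau> \<psi> i (N - i) = (\<Sum>m=1..N - Suc i. \<tau> powr (1 - \<alpha>) * ?l m * \<psi> (i + m))"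
      unfolding discrete_abel_def by (rule sum.mono_neutral_right) (use that in \<open>auto simp: \<psi>_def\<close>)
    also have "\<tau> * \<dots> = ?p * (\<Sum>m=1..N - Suc i. ?l m * (c (Suc (i + m)) - c (i + m)))"
      unfolding sum_distrib_left p using tau
      by (intro sum.cong refl) (auto simp: \<psi>_def power2_eq_square)
    finally show ?thesis .
  qed
  have interior: "(\<Sum>i<N. \<tau> * (F (Suc i) * discrete_abel \<alpha> \<tau> \<psi> (Suc i - 1) (N - (Suc i - 1))))
      = ?p * (\<Sum>i<N. F (Suc i) * (\<Sum>m=1..N - Suc i. ?l m * (c (Suc (i + m)) - c (i + m))))"
    unfolding sum_distrib_left[of ?p]
  proof (intro sum.cong refl)
    fix i assume "i \<in> {..<N}"
    then show "\<tau> * (F (Suc i) * discrete_abel \<alpha> \<tau> \<psi> (Suc i - 1) (N - (Suc i - 1)))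
        = ?p * (F (Suc i) * (\<Sum>m=1..N - Suc i. ?l m * (c (Suc (i + m)) - c (i + m))))"
      using inner[of i] by (simp only: lessThan_iff diff_Suc_1 mult.left_commute[of _ "F (Suc i)"])
  qed
  have initial: "discrete_abel \<alpha> \<tau> \<phi>' 0 N = ?p * (\<Sum>k=1..N. ?l k * c k)"
    unfolding discrete_abel_def sum_distrib_left p using tau
    by (intro sum.cong refl) (auto simp: \<phi>'_def)
  have "set_integrable lebesgue {0<..<real N * \<tau>} \<phi>"
    unfolding N_tau by (rule continuous_set_integrable_Ioo[OF cont])
  from set_integral_step_interp_mult[OF tau this]
  have "(LINT t:{0<..<T}|lebesgue. step_caputo \<alpha> \<tau> N F t * \<phi> t)
      = (\<Sum>k=1..N. discrete_caputo \<alpha> \<tau> F k * c k)"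
    unfolding N_tau step_caputo_def c_eq .
  also have "\<dots> = Gamma \<alpha> * ?p * (\<Sum>k=1..N. (\<Sum>j<k. ?l (k - j) * (F (j + 1) - F j)) * c k)"
    unfolding discrete_caputo_def mult.assoc by (simp only: sum_distrib_left[symmetric])
  also have "\<dots> = Gamma \<alpha> * (?p * (c N * (\<Sum>i<N. F (Suc i) * ?l (N - i)))
      - ?p * (\<Sum>i<N. F (Suc i) * (\<Sum>m=1..N - Suc i. ?l m * (c (Suc (i + m)) - c (i + m))))
      - F 0 * (?p * (\<Sum>k=1..N. ?l k * c k)))"
    by (subst discrete_caputo_summation_by_parts) (simp_all add: caputo_weight.simps algebra_simps)
  finally show ?thesis
    unfolding prod bdry interior initial .
qed

text \<open>
  Each of the three terms converges separately. The initial value term is a discrete Abel integral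
  of \<open>\<phi>\<close> from 0. In the second term the discrete Abel integrals from the running node converge
  boundedly and pointwise, which pairs with \<open>L\<^sup>1\<close> convergence. In the boundary term the rescaled
  weights, read backwards from \<open>T\<close>, are dominated by the kernel \<open>(T - t) powr (- \<alpha>)\<close> and converge
  to a multiple of it: this pairs with the weighted convergence. If \<open>\<phi> T = 0\<close>, the last cell average is \<open>O(\<tau>)\<close>, the
  boundary term is bounded by a multiple of \<open>\<tau> powr (1 - \<alpha>)\<close>, and plain \<open>L\<^sup>1\<close> convergence is enough.
\<close>

lemma step_caputo_tendsto:
  fixes \<alpha> T f0 :: real
    and F :: "nat \<Rightarrow> nat \<Rightarrow> real"
    and f \<phi> D :: "real \<Rightarrow> real"
  assumes alpha: "0 < \<alpha>" "\<alpha> < 1" and T: "0 < T"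
    and initial: "\<And>N. N \<ge> 1 \<Longrightarrow> F N 0 = f0"
    and L1_conv: "weighted_L1_tendsto 0 T (\<lambda>t. 1) (\<lambda>N. step_interp (T / real N) N (F N)) f"
    and cont: "continuous_on {0..T} \<phi>" and D: "continuous_on {0..T} D"
    and deriv: "\<And>x. 0 < x \<Longrightarrow> x < T \<Longrightarrow> (\<phi> has_real_derivative D x) (at x)"
    and no_concentration: "\<phi> T \<noteq> 0 \<Longrightarrow>
      weighted_L1_tendsto 0 T (\<lambda>t. 1 / (T - t) powr \<alpha>) (\<lambda>N. step_interp (T / real N) N (F N)) f"
  shows
    "(\<lambda>N. LINT t:{0<..<T}|lebesgue. step_caputo \<alpha> (T / real N) N (F N) t * \<phi> t)
      \<longlonglongrightarrow> 1 / Gamma (1 - \<alpha>) * (\<phi> T * (LINT t:{0<..<T}|lebesgue. f t / (T - t) powr \<alpha>)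
          - (LINT t:{0<..<T}|lebesgue. f t * (LINT s:{t<..<T}|lebesgue. D s / (s - t) powr \<alpha>))
          - f0 * (LINT s:{0<..<T}|lebesgue. \<phi> s / s powr \<alpha>))"
proof -
  define \<tau> where "\<tau> N = T / real N" for N
  define c where "c N = cell_integral \<phi> (\<tau> N)" for N
  define \<psi> where "\<psi> N k = (if 1 \<le> k \<and> k < N then (c N (Suc k) - c N k) / (\<tau> N)\<^sup>2 else 0)" for N k
  define \<phi>' where "\<phi>' N k = (if 1 \<le> k \<and> k \<le> N then c N k / \<tau> N else 0)" for N k
  define S where "S N = step_interp (\<tau> N) N (\<lambda>j. discrete_abel \<alpha> (\<tau> N) (\<psi> N) (j - 1) (N - (j - 1)))" for N
  define B where "B N = step_interp (\<tau> N) N (\<lambda>j. \<tau> N powr (- \<alpha>) * caputo_weight \<alpha> (N - (j - 1)) * (c N N / \<tau> N))" for N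
  define c0 where "c0 = 1 / (Gamma \<alpha> * Gamma (1 - \<alpha>))"
  define J where "J t = (LINT s:{t<..<T}|lebesgue. D s / (s - t) powr \<alpha>)" for t
  let ?g = "\<lambda>N. step_interp (\<tau> N) N (F N)"
  have tau: "\<tau> N > 0" and N_tau: "real N * \<tau> N = T" if "N \<ge> 1" for N
    using that T by (auto simp: \<tau>_def)
  have tau0: "\<tau> \<longlonglongrightarrow> 0" unfolding \<tau>_def by real_asymp
  obtain M where M: "M \<ge> 0" "\<And>t. t \<in> {0..T} \<Longrightarrow> \<bar>D t\<bar> \<le> M"
    using continuous_on_Icc_abs_bound[OF D] by blast
  obtain M' where M': "M' \<ge> 0" "\<And>t. t \<in> {0..T} \<Longrightarrow> \<bar>\<phi> t\<bar> \<le> M'"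
    using continuous_on_Icc_abs_bound[OF cont] by blast
  have psi: "\<exists>\<eta>\<in>{0..T}. \<bar>\<eta> - real k * \<tau> N\<bar> \<le> \<tau> N \<and> \<psi> N k = D \<eta>" if "1 \<le> k" "k < N" for N k
  proof -
    have "real (Suc k) * \<tau> N \<le> real N * \<tau> N" using that tau[of N] by (intro mult_right_mono) auto
    then have "\<exists>\<eta>\<in>{0..T}. \<bar>\<eta> - real k * \<tau> N\<bar> \<le> \<tau> N
        \<and> cell_integral \<phi> (\<tau> N) (Suc k) - cell_integral \<phi> (\<tau> N) k = (\<tau> N)\<^sup>2 * D \<eta>"
      using that N_tau[of N] by (intro cell_integral_diff_mean_value[OF tau _ _ cont deriv]) auto
    then show ?thesis using that tau[of N] by (auto simp: \<psi>_def c_def)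
  qed
  have phi: "\<exists>\<eta>\<in>{0..T}. \<bar>\<eta> - real k * \<tau> N\<bar> \<le> \<tau> N \<and> \<phi>' N k = \<phi> \<eta>" if "1 \<le> k" "k \<le> N" for N k
  proof -
    have "real k * \<tau> N \<le> real N * \<tau> N" using that tau[of N] by (intro mult_right_mono) auto
    then have "\<exists>\<eta>\<in>{0..T}. \<bar>\<eta> - real k * \<tau> N\<bar> \<le> \<tau> N \<and> cell_integral \<phi> (\<tau> N) k = \<tau> N * \<phi> \<eta>"
      using that N_tau[of N] by (intro cell_integral_mean_value[OF tau _ _ cont]) auto
    then show ?thesis using that tau[of N] by (auto simp: \<phi>'_def c_def)
  qed
  have psi_bound: "\<bar>\<psi> N k\<bar> \<le> M" for N k
  proof (cases "1 \<le> k \<and> k < N")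
    case True
    then obtain \<eta> where "\<eta> \<in> {0..T}" "\<psi> N k = D \<eta>" using psi[of k N] by blast
    then show ?thesis using M(2) by simp
  qed (use M(1) in \<open>auto simp: \<psi>_def\<close>)
  have phi_bound: "\<bar>\<phi>' N k\<bar> \<le> M'" for N k
  proof (cases "1 \<le> k \<and> k \<le> N")
    case True
    then obtain \<eta> where "\<eta> \<in> {0..T}" "\<phi>' N k = \<phi> \<eta>" using phi[of k N] by blast
    then show ?thesis using M'(2) by simp
  qed (use M'(1) in \<open>auto simp: \<phi>'_def\<close>)

  have third: "(\<lambda>N. discrete_abel \<alpha> (\<tau> N) (\<phi>' N) 0 N) \<longlonglongrightarrow> c0 * (LINT s:{0<..<T}|lebesgue. \<phi> s / s powr \<alpha>)"
    using discrete_abel_tendsto[OF alpha T order_refl T _ cont phi[unfolded \<tau>_def] phi_bound, of "\<lambda>_. 0"]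
    by (simp add: c0_def \<tau>_def)

  have second: "(\<lambda>N. LINT t:{0<..<T}|lebesgue. ?g N t * S N t) \<longlonglongrightarrow> (LINT t:{0<..<T}|lebesgue. f t * (c0 * J t))"
  proof (rule weighted_L1_tendsto_pairing[OF L1_conv[folded \<tau>_def]])
    show "S N \<in> borel_measurable lebesgue" for N
      unfolding S_def by (rule step_interp_lebesgue_measurable)
    show "\<bar>S N t\<bar> \<le> (M * T powr (1 - \<alpha>)) * 1" if "0 < t" "t < T" for N t
    proof (cases "N = 0")
      case False
      let ?i = "nat \<lceil>t / \<tau> N\<rceil> - 1"
      have "real (N - ?i) * \<tau> N \<le> real N * \<tau> N" using tau[of N] False by (intro mult_right_mono) auto
      then have "\<bar>discrete_abel \<alpha> (\<tau> N) (\<psi> N) ?i (N - ?i)\<bar> \<le> M * T powr (1 - \<alpha>)"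
        using False N_tau[of N] by (intro discrete_abel_bound[OF alpha tau _ psi_bound]) auto
      then show ?thesis unfolding S_def using that False tau[of N] N_tau[of N] by (simp add: step_interp_eq)
    qed (use M in \<open>simp add: S_def\<close>)
    show "(\<lambda>N. S N t) \<longlonglongrightarrow> c0 * J t" if t: "0 < t" "t < T" for t
    proof -
      define i where "i N = nat \<lceil>t / \<tau> N\<rceil> - 1" for N
      have i: "(\<lambda>N. real (i N) * \<tau> N) \<longlonglongrightarrow> t"
      proof (rule Lim_transform_eventually)
        show "(\<lambda>N. real (nat \<lceil>t / \<tau> N\<rceil>) * \<tau> N - \<tau> N) \<longlonglongrightarrow> t"
          using tendsto_diff[OF cell_index_tendsto[OF T t(1), folded \<tau>_def] tau0] by simp
        show "\<forall>\<^sub>F N in sequentially. real (nat \<lceil>t / \<tau> N\<rceil>) * \<tau> N - \<tau> N = real (i N) * \<tau> N"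
          using eventually_ge_at_top[of 1]
        proof eventually_elim
          case (elim N)
          from cell_index_bounds(3)[OF tau[OF elim] t(1)] show ?case
            by (simp add: i_def of_nat_diff left_diff_distrib)
        qed
      qed
      have "(\<lambda>N. discrete_abel \<alpha> (\<tau> N) (\<psi> N) (i N) (N - i N)) \<longlonglongrightarrow> c0 * J t"
        unfolding c0_def J_def \<tau>_def
        using t by (intro discrete_abel_tendsto[OF alpha T _ _ i[unfolded \<tau>_def] D psi[unfolded \<tau>_def] psi_bound]) auto
      moreover have "\<forall>\<^sub>F N in sequentially. discrete_abel \<alpha> (\<tau> N) (\<psi> N) (i N) (N - i N) = S N t"
        using eventually_ge_at_top[of 1]
      proof eventually_elim
        case (elim N)
        then show ?case using t tau[of N] N_tau[of N] by (simp add: S_def step_interp_eq i_def)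
      qed
      ultimately show ?thesis by (rule Lim_transform_eventually)
    qed
  qed auto

  \<comment> \<open>The last cell ends at \<open>T\<close>, so its average is a value of \<open>\<phi>\<close> within \<open>\<tau>\<close> of \<open>T\<close>.\<close>
  have last_cell: "\<exists>\<eta>\<in>{0..T}. \<bar>\<eta> - T\<bar> \<le> \<tau> N \<and> c N N / \<tau> N = \<phi> \<eta>" if "N \<ge> 1" for N
    using phi[of N N] that N_tau[OF that] by (simp add: \<phi>'_def)
  have last_cell_tendsto: "(\<lambda>N. c N N / \<tau> N) \<longlonglongrightarrow> \<phi> T"
  proof -
    define \<eta> where "\<eta> N = (SOME \<eta>. \<eta> \<in> {0..T} \<and> \<bar>\<eta> - T\<bar> \<le> \<tau> N \<and> c N N / \<tau> N = \<phi> \<eta>)" for N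
    have eta: "\<eta> N \<in> {0..T} \<and> \<bar>\<eta> N - T\<bar> \<le> \<tau> N \<and> c N N / \<tau> N = \<phi> (\<eta> N)" if "N \<ge> 1" for N
      unfolding \<eta>_def by (rule someI_ex) (use last_cell[OF that] in blast)
    have "(\<lambda>N. \<eta> N - T) \<longlonglongrightarrow> 0"
    proof (rule Lim_null_comparison[OF _ tau0])
      show "\<forall>\<^sub>F N in sequentially. norm (\<eta> N - T) \<le> \<tau> N"
        using eventually_ge_at_top[of 1]
        by eventually_elim (use eta in \<open>simp only: real_norm_def\<close>)
    qed
    then have "\<eta> \<longlonglongrightarrow> T" using LIM_zero_cancel by blast
    moreover have "\<forall>\<^sub>F N in sequentially. \<eta> N \<in> {0..T}"
      using eventually_ge_at_top[of 1] by eventually_elim (use eta in blast)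
    ultimately have "(\<lambda>N. \<phi> (\<eta> N)) \<longlonglongrightarrow> \<phi> T"
      using T by (intro continuous_on_tendsto_compose[OF cont]) auto
    moreover have "\<forall>\<^sub>F N in sequentially. \<phi> (\<eta> N) = c N N / \<tau> N"
      using eventually_ge_at_top[of 1] by eventually_elim (use eta in simp)
    ultimately show ?thesis by (rule Lim_transform_eventually)
  qed
  have B_eq: "B N t = \<tau> N powr (- \<alpha>) * caputo_weight \<alpha> (N - (nat \<lceil>t / \<tau> N\<rceil> - 1)) * (c N N / \<tau> N)"
    if "N \<ge> 1" "0 < t" "t < T" for N t
    using that tau[of N] N_tau[of N] by (simp add: B_def step_interp_eq)
  \<comment> \<open>The node from which the weight is read backwards lies within \<open>\<tau>\<close> of \<open>T - t\<close>, and never below it.\<close>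
  have dist_T: "real (N - (nat \<lceil>t / \<tau> N\<rceil> - 1)) * \<tau> N = T - real (nat \<lceil>t / \<tau> N\<rceil>) * \<tau> N + \<tau> N"
    if "N \<ge> 1" "0 < t" "t < T" for N t
  proof -
    have "nat \<lceil>t / \<tau> N\<rceil> \<le> N" "1 \<le> nat \<lceil>t / \<tau> N\<rceil>"
      using that cell_index_le[OF tau, of N t N] cell_index_bounds(3)[OF tau, of N t] N_tau[of N] by auto
    then have idx: "real (N - (nat \<lceil>t / \<tau> N\<rceil> - 1)) = real N - real (nat \<lceil>t / \<tau> N\<rceil>) + 1"
      by (simp add: of_nat_diff)
    show ?thesis unfolding idx N_tau[OF that(1), symmetric]
      by (simp only: left_diff_distrib distrib_right mult_1)
  qed
  have B_meas: "B N \<in> borel_measurable lebesgue" for N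
    unfolding B_def by (rule step_interp_lebesgue_measurable)
  have B_lim: "(\<lambda>N. B N t) \<longlonglongrightarrow> c0 * (1 / (T - t) powr \<alpha>) * \<phi> T" if t: "0 < t" "t < T" for t
  proof -
    define m where "m N = N - (nat \<lceil>t / \<tau> N\<rceil> - 1)" for N
    have "(\<lambda>N. real (m N) * \<tau> N) \<longlonglongrightarrow> T - t"
    proof (rule Lim_transform_eventually)
      show "(\<lambda>N. T - real (nat \<lceil>t / \<tau> N\<rceil>) * \<tau> N + \<tau> N) \<longlonglongrightarrow> T - t"
        using tendsto_add[OF tendsto_diff[OF tendsto_const cell_index_tendsto[OF T t(1), folded \<tau>_def]] tau0] by simp
      show "\<forall>\<^sub>F N in sequentially. T - real (nat \<lceil>t / \<tau> N\<rceil>) * \<tau> N + \<tau> N = real (m N) * \<tau> N"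
        using eventually_ge_at_top[of 1] by eventually_elim (use dist_T t in \<open>simp add: m_def\<close>)
    qed
    then have "(\<lambda>N. \<tau> N powr (- \<alpha>) * caputo_weight \<alpha> (m N)) \<longlonglongrightarrow> c0 * (1 / (T - t) powr \<alpha>)"
      unfolding \<tau>_def c0_def using t by (intro scaled_weight_tendsto[OF alpha T]) auto
    from tendsto_mult[OF this last_cell_tendsto] show ?thesis
      by (rule Lim_transform_eventually)
         (use eventually_ge_at_top[of 1] in \<open>eventually_elim, use B_eq t in \<open>simp add: m_def\<close>\<close>)
  qed
  have B_weight: "\<tau> N powr (- \<alpha>) * caputo_weight \<alpha> (N - (nat \<lceil>t / \<tau> N\<rceil> - 1)) \<le> 1 / (T - t) powr \<alpha>"
    if "N \<ge> 1" "0 < t" "t < T" for N t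
  proof (rule scaled_weight_le[OF alpha tau[OF that(1)]])
    show "T - t \<le> real (N - (nat \<lceil>t / \<tau> N\<rceil> - 1)) * \<tau> N"
      unfolding dist_T[OF that] using cell_index_bounds(2)[OF tau[OF that(1)] that(2)] by linarith
  qed (use that in simp)
  have first: "(\<lambda>N. LINT t:{0<..<T}|lebesgue. ?g N t * B N t)
      \<longlonglongrightarrow> (LINT t:{0<..<T}|lebesgue. f t * (c0 * (1 / (T - t) powr \<alpha>) * \<phi> T))"
  proof (cases "\<phi> T = 0")
    case False
    show ?thesis
    proof (rule weighted_L1_tendsto_pairing[OF no_concentration[OF False, folded \<tau>_def] _ _ B_meas _ B_lim])
      have "(\<lambda>t. 1 / (T - t) powr \<alpha>) \<in> borel_measurable borel" by measurable
      then show "(\<lambda>t. 1 / (T - t) powr \<alpha>) \<in> borel_measurable lebesgue"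
        by (intro measurable_completion) simp
      show "\<bar>B N t\<bar> \<le> M' * (1 / (T - t) powr \<alpha>)" if t: "0 < t" "t < T" for N t
      proof (cases "N = 0")
        case False
        have "\<exists>\<eta>\<in>{0..T}. c N N / \<tau> N = \<phi> \<eta>" using last_cell[of N] False by auto
        then have "\<bar>c N N / \<tau> N\<bar> \<le> M'" using M'(2) by metis
        then have "\<tau> N powr (- \<alpha>) * caputo_weight \<alpha> (N - (nat \<lceil>t / \<tau> N\<rceil> - 1)) * \<bar>c N N / \<tau> N\<bar>
            \<le> 1 / (T - t) powr \<alpha> * M'"
          using B_weight[of N t] t False by (intro mult_mono) auto
        then show ?thesis
          using B_eq[of N t] t False caputo_weight_nonneg[OF alpha] by (simp add: abs_mult mult.commute)
      qed (use M' in \<open>simp add: B_def\<close>)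
    qed auto
  next
    case True
    show ?thesis
    proof (rule weighted_L1_tendsto_pairing[OF L1_conv[folded \<tau>_def] _ _ B_meas _ B_lim])
      show "\<bar>B N t\<bar> \<le> M * T powr (1 - \<alpha>) * 1" if t: "0 < t" "t < T" for N t
      proof (cases "N = 0")
        case False
        then have N: "N \<ge> 1" by simp
        have "\<bar>c N N / \<tau> N\<bar> \<le> M * \<tau> N"
        proof -
          obtain \<eta> where eta: "\<eta> \<in> {0..T}" "\<bar>\<eta> - T\<bar> \<le> \<tau> N" "c N N / \<tau> N = \<phi> \<eta>"
            using last_cell[OF N] by blast
          have "\<bar>\<phi> T - \<phi> \<eta>\<bar> \<le> M * (T - \<eta>)"
          proof (cases "\<eta> = T")
            case False
            then have "\<eta> < T" using eta by simp
            moreover have "continuous_on {\<eta>..T} \<phi>" using eta by (intro continuous_on_subset[OF cont]) auto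
            ultimately obtain x where x: "\<eta> < x" "x < T" "\<phi> T - \<phi> \<eta> = D x * (T - \<eta>)"
              using mvt_simple_interior[of \<eta> T \<phi> D] deriv eta by auto
            then have "\<bar>D x\<bar> \<le> M" using eta by (intro M) auto
            then show ?thesis using x eta by (simp add: abs_mult mult_right_mono)
          qed simp
          also have "\<dots> \<le> M * \<tau> N" using eta M by (intro mult_left_mono) auto
          finally show ?thesis using True eta by simp
        qed
        moreover have "\<tau> N powr (- \<alpha>) * caputo_weight \<alpha> (N - (nat \<lceil>t / \<tau> N\<rceil> - 1)) \<le> \<tau> N powr (- \<alpha>)"
        proof -
          have "real (N - (nat \<lceil>t / \<tau> N\<rceil> - 1)) * \<tau> N > 0"
            unfolding dist_T[OF N t] using cell_index_bounds(2)[OF tau[OF N] t(1)] t by linarith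
          then have "1 \<le> N - (nat \<lceil>t / \<tau> N\<rceil> - 1)"
            by (cases "N - (nat \<lceil>t / \<tau> N\<rceil> - 1) = 0") simp_all
          from scaled_weight_le[OF alpha tau[OF N] tau[OF N], of "N - (nat \<lceil>t / \<tau> N\<rceil> - 1)"] this tau[OF N]
          show ?thesis by (simp add: powr_minus_divide)
        qed
        ultimately have "\<tau> N powr (- \<alpha>) * caputo_weight \<alpha> (N - (nat \<lceil>t / \<tau> N\<rceil> - 1)) * \<bar>c N N / \<tau> N\<bar>
            \<le> \<tau> N powr (- \<alpha>) * (M * \<tau> N)"
          by (intro mult_mono) auto
        also have "\<dots> = M * \<tau> N powr (1 - \<alpha>)"
          using tau[OF N] by (simp add: powr_diff powr_minus_divide)
        also have "\<dots> \<le> M * T powr (1 - \<alpha>)"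
        proof (intro mult_left_mono powr_mono2)
          show "\<tau> N \<le> T" using N T by (simp add: \<tau>_def field_simps mult_le_cancel_left1)
        qed (use alpha M tau[OF N] in auto)
        finally show ?thesis
          using B_eq[OF N t] caputo_weight_nonneg[OF alpha] by (simp add: abs_mult)
      qed (use M in \<open>simp add: B_def\<close>)
    qed auto
  qed

  have split: "\<forall>\<^sub>F N in sequentially.
      Gamma \<alpha> * ((LINT t:{0<..<T}|lebesgue. ?g N t * B N t) - (LINT t:{0<..<T}|lebesgue. ?g N t * S N t)
        - f0 * discrete_abel \<alpha> (\<tau> N) (\<phi>' N) 0 N)
      = (LINT t:{0<..<T}|lebesgue. step_caputo \<alpha> (\<tau> N) N (F N) t * \<phi> t)"
    using eventually_ge_at_top[of 1]
  proof eventually_elim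
    case (elim N)
    from step_caputo_pairing[OF elim T alpha cont, of "F N"] initial[OF elim] show ?case
      unfolding S_def B_def \<psi>_def[abs_def] \<phi>'_def[abs_def] c_def \<tau>_def by simp
  qed
  have "(\<lambda>N. Gamma \<alpha> * ((LINT t:{0<..<T}|lebesgue. ?g N t * B N t) - (LINT t:{0<..<T}|lebesgue. ?g N t * S N t)
        - f0 * discrete_abel \<alpha> (\<tau> N) (\<phi>' N) 0 N))
      \<longlonglongrightarrow> Gamma \<alpha> * ((LINT t:{0<..<T}|lebesgue. f t * (c0 * (1 / (T - t) powr \<alpha>) * \<phi> T))
        - (LINT t:{0<..<T}|lebesgue. f t * (c0 * J t))
        - f0 * (c0 * (LINT s:{0<..<T}|lebesgue. \<phi> s / s powr \<alpha>)))"
    by (intro tendsto_mult tendsto_diff tendsto_const first second third)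
  from Lim_transform_eventually[OF this split]
  have lim: "(\<lambda>N. LINT t:{0<..<T}|lebesgue. step_caputo \<alpha> (\<tau> N) N (F N) t * \<phi> t)
      \<longlonglongrightarrow> Gamma \<alpha> * ((LINT t:{0<..<T}|lebesgue. f t * (c0 * (1 / (T - t) powr \<alpha>) * \<phi> T))
        - (LINT t:{0<..<T}|lebesgue. f t * (c0 * J t))
        - f0 * (c0 * (LINT s:{0<..<T}|lebesgue. \<phi> s / s powr \<alpha>)))" .
  have "Gamma \<alpha> > 0" using alpha by simp
  then have G: "Gamma \<alpha> * c0 = 1 / Gamma (1 - \<alpha>)" by (simp add: c0_def)
  have i1: "(LINT t:{0<..<T}|lebesgue. f t * (c0 * (1 / (T - t) powr \<alpha>) * \<phi> T))
      = c0 * (\<phi> T * (LINT t:{0<..<T}|lebesgue. f t / (T - t) powr \<alpha>))"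
  proof -
    have "(LINT t:{0<..<T}|lebesgue. (c0 * \<phi> T) * (f t / (T - t) powr \<alpha>))
        = (c0 * \<phi> T) * (LINT t:{0<..<T}|lebesgue. f t / (T - t) powr \<alpha>)"
      by (rule set_integral_mult_right)
    then show ?thesis by (simp add: mult_ac)
  qed
  have i2: "(LINT t:{0<..<T}|lebesgue. f t * (c0 * J t)) = c0 * (LINT t:{0<..<T}|lebesgue. f t * J t)"
  proof -
    have "(LINT t:{0<..<T}|lebesgue. c0 * (f t * J t)) = c0 * (LINT t:{0<..<T}|lebesgue. f t * J t)"
      by (rule set_integral_mult_right)
    then show ?thesis by (simp add: mult_ac)
  qed
  have factor: "Gamma \<alpha> * (c0 * x - c0 * y - f0 * (c0 * z)) = Gamma \<alpha> * c0 * (x - y - f0 * z)" for x y z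
    by (simp add: algebra_simps)
  show ?thesis using lim unfolding i1 i2 factor G unfolding J_def \<tau>_def .
qed

section \<open>Integration by parts for the Caputo derivative\<close>

lemma sigma_finite_lebesgue: "sigma_finite_measure (lebesgue :: real measure)"
proof
  obtain A :: "real set set" where A: "countable A" "A \<subseteq> sets lborel" "\<Union>A = space lborel"
      "\<forall>a\<in>A. emeasure lborel a \<noteq> \<infinity>"
    using lborel.sigma_finite_countable by blast
  then show "\<exists>A. countable A \<and> A \<subseteq> sets (lebesgue :: real measure) \<and> \<Union>A = space lebesgue
      \<and> (\<forall>a\<in>A. emeasure lebesgue a \<noteq> \<infinity>)"
    by (intro exI[of _ A]) (auto simp: subset_eq emeasure_completion)
qed

text \<open>
  Integrability on the product space follows from that of \<open>p\<close>, since the sections of the kernel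
  have uniformly bounded \<open>L\<^sup>1\<close> norm.
\<close>

lemma Fubini_bounded_kernel:
  fixes p :: "real \<Rightarrow> real" and K :: "real \<Rightarrow> real \<Rightarrow> real"
  assumes p: "integrable lebesgue p"
    and K_meas: "(\<lambda>(s, t). K s t) \<in> borel_measurable (lebesgue \<Otimes>\<^sub>M lebesgue)"
    and K_int: "\<And>s. integrable lebesgue (K s)"
    and K_bound: "\<And>s. (LINT t|lebesgue. \<bar>K s t\<bar>) \<le> B"
  shows "(LINT s|lebesgue. p s * (LINT t|lebesgue. K s t)) = (LINT t|lebesgue. LINT s|lebesgue. p s * K s t)"
    and "integrable lebesgue (\<lambda>s. p s * (LINT t|lebesgue. K s t))"
proof -
  interpret L: sigma_finite_measure "lebesgue :: real measure" by (rule sigma_finite_lebesgue)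
  interpret pair_sigma_finite "lebesgue :: real measure" "lebesgue :: real measure" ..
  note [measurable] = K_meas
  have [measurable]: "p \<in> borel_measurable lebesgue" using p by simp
  have int: "integrable (lebesgue \<Otimes>\<^sub>M lebesgue) (\<lambda>(s, t). p s * K s t)"
  proof (rule Fubini_integrable)
    show "(\<lambda>(s, t). p s * K s t) \<in> borel_measurable (lebesgue \<Otimes>\<^sub>M lebesgue)" by measurable
    show "AE s in lebesgue. integrable lebesgue (\<lambda>t. case (s, t) of (s, t) \<Rightarrow> p s * K s t)"
      using K_int by simp
    show "integrable lebesgue (\<lambda>s. LINT t|lebesgue. norm (case (s, t) of (s, t) \<Rightarrow> p s * K s t))"
    proof (rule Bochner_Integration.integrable_bound)
      show "integrable lebesgue (\<lambda>s. B * \<bar>p s\<bar>)" using p by simp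
      show "(\<lambda>s. LINT t|lebesgue. norm (case (s, t) of (s, t) \<Rightarrow> p s * K s t)) \<in> borel_measurable lebesgue"
        by measurable
      show "AE s in lebesgue. norm (LINT t|lebesgue. norm (case (s, t) of (s, t) \<Rightarrow> p s * K s t)) \<le> norm (B * \<bar>p s\<bar>)"
      proof (intro AE_I2)
        fix s
        have "norm (LINT t|lebesgue. norm (case (s, t) of (s, t) \<Rightarrow> p s * K s t)) = \<bar>p s\<bar> * (LINT t|lebesgue. \<bar>K s t\<bar>)"
          by (simp add: abs_mult)
        also have "\<dots> \<le> \<bar>p s\<bar> * B" by (intro mult_left_mono K_bound) simp
        also have "\<dots> \<le> norm (B * \<bar>p s\<bar>)" by (simp add: mult.commute abs_mult)
            (metis abs_ge_self abs_ge_zero mult_right_mono)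
        finally show "norm (LINT t|lebesgue. norm (case (s, t) of (s, t) \<Rightarrow> p s * K s t)) \<le> norm (B * \<bar>p s\<bar>)" .
      qed
    qed
  qed
  show "(LINT s|lebesgue. p s * (LINT t|lebesgue. K s t)) = (LINT t|lebesgue. LINT s|lebesgue. p s * K s t)"
    using Fubini_integral[OF int] by simp
  show "integrable lebesgue (\<lambda>s. p s * (LINT t|lebesgue. K s t))"
    using integrable_fst'[OF int] by simp
qed

text \<open>
  Used with the singular kernel, exponent \<open>\<alpha>\<close>, and with exponent 0, where it exchanges the
  order of integration over the triangle itself.
\<close>

lemma Fubini_triangle:
  fixes p q :: "real \<Rightarrow> real" and r T a B :: real
  assumes p: "set_integrable lebesgue {r<..<T} p"
    and q: "set_borel_measurable lebesgue {r<..<T} q"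
    and int: "\<And>s. r < s \<Longrightarrow> s < T \<Longrightarrow> set_integrable lebesgue {s<..<T} (\<lambda>t. q t / (t - s) powr a)"
    and bound: "\<And>s. r < s \<Longrightarrow> s < T \<Longrightarrow> (LINT t:{s<..<T}|lebesgue. \<bar>q t / (t - s) powr a\<bar>) \<le> B"
  shows "(LINT s:{r<..<T}|lebesgue. p s * (LINT t:{s<..<T}|lebesgue. q t / (t - s) powr a))
      = (LINT t:{r<..<T}|lebesgue. q t * (LINT s:{r<..<t}|lebesgue. p s / (t - s) powr a))"
    and "set_integrable lebesgue {r<..<T} (\<lambda>s. p s * (LINT t:{s<..<T}|lebesgue. q t / (t - s) powr a))"
proof -
  define P where "P s = indicator {r<..<T} s * p s" for s
  define K where "K s t = (if r < s \<and> s < t \<and> t < T then q t / (t - s) powr a else 0)" for s t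
  have K_eq: "K s t = indicator {s<..<T} t *\<^sub>R (q t / (t - s) powr a)" if "r < s" for s t
    using that by (auto simp: K_def indicator_def)
  have K_0: "K s = (\<lambda>t. 0)" if "\<not> (r < s \<and> s < T)" for s
    using that by (auto simp: K_def fun_eq_iff)
  have K_alt: "(\<lambda>(s, t). K s t) = (\<lambda>z. (indicator {r<..<T} (snd z) *\<^sub>R q (snd z))
      * (if r < fst z \<and> fst z < snd z then 1 / (snd z - fst z) powr a else 0))"
    by (auto simp: K_def fun_eq_iff indicator_def)
  have P: "integrable lebesgue P" using p by (simp add: P_def[abs_def] set_integrable_def)
  have K_meas: "(\<lambda>(s, t). K s t) \<in> borel_measurable (lebesgue \<Otimes>\<^sub>M lebesgue)"
  proof -
    have id: "(\<lambda>x. x) \<in> (lebesgue :: real measure) \<rightarrow>\<^sub>M borel" by (intro measurable_completion) simp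
    have [measurable]: "fst \<in> lebesgue \<Otimes>\<^sub>M lebesgue \<rightarrow>\<^sub>M (borel :: real measure)"
      "snd \<in> lebesgue \<Otimes>\<^sub>M lebesgue \<rightarrow>\<^sub>M (borel :: real measure)"
      by (rule measurable_compose[OF measurable_fst id], rule measurable_compose[OF measurable_snd id])
    have [measurable]: "(\<lambda>z. indicator {r<..<T} (snd z) *\<^sub>R q (snd z)) \<in> borel_measurable (lebesgue \<Otimes>\<^sub>M lebesgue)"
      using measurable_compose[OF measurable_snd q[unfolded set_borel_measurable_def]] by simp
    show ?thesis unfolding K_alt by measurable
  qed
  have K_int: "integrable lebesgue (K s)" for s
  proof (cases "r < s \<and> s < T")
    case True
    then have "K s = (\<lambda>t. indicator {s<..<T} t *\<^sub>R (q t / (t - s) powr a))" by (intro ext K_eq) simp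
    then show ?thesis using int[of s] True by (simp add: set_integrable_def)
  qed (simp add: K_0)
  have K_bound: "(LINT t|lebesgue. \<bar>K s t\<bar>) \<le> max B 0" for s
  proof (cases "r < s \<and> s < T")
    case True
    then have "\<bar>K s t\<bar> = indicator {s<..<T} t *\<^sub>R \<bar>q t / (t - s) powr a\<bar>" for t
      by (simp add: K_eq abs_mult)
    then show ?thesis using bound[of s] True by (simp add: set_lebesgue_integral_def)
  qed (simp add: K_0)
  note Fub = Fubini_bounded_kernel[OF P K_meas K_int K_bound]
  have left: "P s * (LINT t|lebesgue. K s t)
      = indicator {r<..<T} s *\<^sub>R (p s * (LINT t:{s<..<T}|lebesgue. q t / (t - s) powr a))" for s
    by (cases "r < s \<and> s < T") (auto simp: P_def K_eq set_lebesgue_integral_def indicator_def)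
  have right: "(LINT s|lebesgue. P s * K s t)
      = indicator {r<..<T} t *\<^sub>R (q t * (LINT s:{r<..<t}|lebesgue. p s / (t - s) powr a))" for t
  proof -
    have "P s * K s t = (indicator {r<..<T} t * q t) * (indicator {r<..<t} s *\<^sub>R (p s / (t - s) powr a))" for s
      by (auto simp: P_def K_def indicator_def)
    then have "(LINT s|lebesgue. P s * K s t)
        = (LINT s|lebesgue. (indicator {r<..<T} t * q t) * (indicator {r<..<t} s *\<^sub>R (p s / (t - s) powr a)))"
      by (simp only:)
    also have "\<dots> = (indicator {r<..<T} t * q t) * (LINT s:{r<..<t}|lebesgue. p s / (t - s) powr a)"
      unfolding set_lebesgue_integral_def by (rule integral_mult_right_zero)
    finally show ?thesis by simp
  qed
  show "(LINT s:{r<..<T}|lebesgue. p s * (LINT t:{s<..<T}|lebesgue. q t / (t - s) powr a))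
      = (LINT t:{r<..<T}|lebesgue. q t * (LINT s:{r<..<t}|lebesgue. p s / (t - s) powr a))"
    using Fub(1) unfolding left right set_lebesgue_integral_def .
  show "set_integrable lebesgue {r<..<T} (\<lambda>s. p s * (LINT t:{s<..<T}|lebesgue. q t / (t - s) powr a))"
    using Fub(2) unfolding left set_integrable_def .
qed

lemma set_integrable_continuous_mult:
  fixes h w :: "real \<Rightarrow> real"
  assumes "continuous_on {a..b} h" "set_integrable lebesgue {a<..<b} w"
  shows "set_integrable lebesgue {a<..<b} (\<lambda>t. h t * w t)"
proof (rule absolutely_integrable_bounded_measurable_product_real)
  show "h \<in> borel_measurable (lebesgue_on {a<..<b})"
    by (intro continuous_imp_measurable_on_sets_lebesgue continuous_on_subset[OF assms(1)]) auto
  show "bounded (h ` {a<..<b})"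
    by (rule bounded_subset[OF compact_imp_bounded[OF compact_continuous_image[OF assms(1) compact_Icc]]]) auto
qed (use assms in auto)

lemma abel_integrand:
  fixes h :: "real \<Rightarrow> real" and s T \<alpha> M :: real
  assumes "\<alpha> < 1" "0 \<le> s" "s \<le> T" and cont: "continuous_on {0..T} h"
    and M: "\<And>t. t \<in> {0..T} \<Longrightarrow> \<bar>h t\<bar> \<le> M"
  shows abel_integrable: "set_integrable lebesgue {s<..<T} (\<lambda>t. h t / (t - s) powr \<alpha>)"
    and abel_integral_bound: "(LINT t:{s<..<T}|lebesgue. \<bar>h t / (t - s) powr \<alpha>\<bar>) \<le> M * (T powr (1 - \<alpha>) / (1 - \<alpha>))"
proof -
  have w: "set_integrable lebesgue {s<..<T} (\<lambda>t. 1 / (t - s) powr \<alpha>)"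
    using assms by (intro set_integrable_powr_left) auto
  have "continuous_on {s..T} h" by (rule continuous_on_subset[OF cont]) (use assms in auto)
  from set_integrable_continuous_mult[OF this w]
  show int: "set_integrable lebesgue {s<..<T} (\<lambda>t. h t / (t - s) powr \<alpha>)" by simp
  have "(LINT t:{s<..<T}|lebesgue. \<bar>h t / (t - s) powr \<alpha>\<bar>)
      \<le> (LINT t:{s<..<T}|lebesgue. M * (1 / (t - s) powr \<alpha>))"
  proof (rule set_integral_mono)
    show "set_integrable lebesgue {s<..<T} (\<lambda>t. \<bar>h t / (t - s) powr \<alpha>\<bar>)"
      by (rule set_integrable_abs[OF int])
    show "set_integrable lebesgue {s<..<T} (\<lambda>t. M * (1 / (t - s) powr \<alpha>))"
      using w by (intro set_integrable_mult_right) simp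
    show "\<bar>h t / (t - s) powr \<alpha>\<bar> \<le> M * (1 / (t - s) powr \<alpha>)" if "t \<in> {s<..<T}" for t
      using M[of t] that assms by (simp add: divide_right_mono)
  qed
  also have "\<dots> = M * (LINT t:{s<..<T}|lebesgue. 1 / (t - s) powr \<alpha>)"
    by (rule set_integral_mult_right)
  also have "\<dots> = M * ((T - s) powr (1 - \<alpha>) / (1 - \<alpha>))"
    using assms by (subst set_integral_powr_left) auto
  also have "\<dots> \<le> M * (T powr (1 - \<alpha>) / (1 - \<alpha>))"
    using assms order_trans[OF abs_ge_zero M[of T]]
    by (intro mult_left_mono divide_right_mono powr_mono2) auto
  finally show "(LINT t:{s<..<T}|lebesgue. \<bar>h t / (t - s) powr \<alpha>\<bar>) \<le> M * (T powr (1 - \<alpha>) / (1 - \<alpha>))" .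
qed

lemma continuous_borel_measurable_Ioo:
  fixes h :: "real \<Rightarrow> real"
  assumes "continuous_on {a..b} h" "a \<le> r"
  shows "set_borel_measurable lebesgue {r<..<b} h"
proof -
  have "continuous_on {r..b} h" by (rule continuous_on_subset[OF assms(1)]) (use assms in auto)
  from continuous_set_integrable_Ioo[OF this] show ?thesis
    by (simp add: set_integrable_def set_borel_measurable_def)
qed

text \<open>
  Minus \<open>H\<close> is the derivative of the right Abel integral of \<open>\<phi>\<close>; here this appears in integrated form.
  Exchanging the order of integration turns the double integral of \<open>D\<close> into the integral of \<open>D t * e t\<close>
  with \<open>e\<close> the primitive of the kernel that vanishes at \<open>r\<close>, and then the product rule for
  \<open>\<phi> t * e t\<close> applies.
\<close>

lemma abel_integral_by_parts:
  assumes alpha: "0 < \<alpha>" "\<alpha> < 1" and r: "0 \<le> r" "r \<le> T"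
    and cont: "continuous_on {0..T} \<phi>" and D: "continuous_on {0..T} D"
    and deriv: "\<And>x. 0 < x \<Longrightarrow> x < T \<Longrightarrow> (\<phi> has_real_derivative D x) (at x)"
  defines "H \<equiv> (\<lambda>s. \<phi> T / (T - s) powr \<alpha> - (LINT t:{s<..<T}|lebesgue. D t / (t - s) powr \<alpha>))"
  shows "(LINT s:{r<..<T}|lebesgue. H s) = (LINT t:{r<..<T}|lebesgue. \<phi> t / (t - r) powr \<alpha>)"
    and "set_integrable lebesgue {r<..<T} (\<lambda>s. LINT t:{s<..<T}|lebesgue. D t / (t - s) powr \<alpha>)"
    and "set_integrable lebesgue {r<..<T} H"
proof -
  obtain M where M: "M \<ge> 0" "\<And>t. t \<in> {0..T} \<Longrightarrow> \<bar>D t\<bar> \<le> M"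
    using continuous_on_Icc_abs_bound[OF D] by blast
  let ?J = "\<lambda>s. LINT t:{s<..<T}|lebesgue. D t / (t - s) powr \<alpha>"
  define e where "e t = (t - r) powr (1 - \<alpha>) / (1 - \<alpha>)" for t
  have e_cont: "continuous_on {r..T} e"
    unfolding e_def using alpha by (auto intro!: continuous_intros continuous_on_powr')
  have one: "set_integrable lebesgue {r<..<T} (\<lambda>_. 1 :: real)"
    by (intro continuous_set_integrable_Ioo continuous_intros)
  note Fub = Fubini_triangle[OF one continuous_borel_measurable_Ioo[OF D r(1)]
      abel_integrable[OF alpha(2) _ _ D M(2)] abel_integral_bound[OF alpha(2) _ _ D M(2)]]
  have J_int: "set_integrable lebesgue {r<..<T} ?J"
    using Fub(2) r by simp
  then show "set_integrable lebesgue {r<..<T} ?J" .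
  have w: "set_integrable lebesgue {r<..<T} (\<lambda>s. \<phi> T / (T - s) powr \<alpha>)"
    using set_integrable_mult_right[OF set_integrable_powr_right[OF alpha(2) r(2)], of "\<phi> T"] by simp
  show "set_integrable lebesgue {r<..<T} H"
    unfolding H_def by (intro set_integral_diff(1) w J_int)
  have J_eq: "(LINT s:{r<..<T}|lebesgue. ?J s) = (LINT t:{r<..<T}|lebesgue. D t * e t)"
  proof -
    have "(LINT s:{r<..<T}|lebesgue. ?J s)
        = (LINT t:{r<..<T}|lebesgue. D t * (LINT s:{r<..<t}|lebesgue. 1 / (t - s) powr \<alpha>))"
      using Fub(1) r by simp
    also have "\<dots> = (LINT t:{r<..<T}|lebesgue. D t * e t)"
      by (rule set_lebesgue_integral_cong) (auto simp: e_def set_integral_powr_right[OF alpha(2)])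
    finally show ?thesis .
  qed
  have cont_r: "continuous_on {r..T} \<phi>" "continuous_on {r..T} D"
    using cont D r by (auto intro: continuous_on_subset)
  have int1: "set_integrable lebesgue {r<..<T} (\<lambda>t. D t * e t)"
    by (intro continuous_set_integrable_Ioo continuous_on_mult cont_r e_cont)
  have int2: "set_integrable lebesgue {r<..<T} (\<lambda>t. \<phi> t / (t - r) powr \<alpha>)"
    using set_integrable_continuous_mult[OF cont_r(1) set_integrable_powr_left[OF alpha(2) r(2)]] by simp
  have "(LINT t:{r<..<T}|lebesgue. D t * e t + \<phi> t / (t - r) powr \<alpha>) = \<phi> T * e T - \<phi> r * e r"
  proof (rule set_integral_FTC[OF r(2)])
    show "continuous_on {r..T} (\<lambda>t. \<phi> t * e t)" by (intro continuous_on_mult cont_r e_cont)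
    show "set_integrable lebesgue {r<..<T} (\<lambda>t. D t * e t + \<phi> t / (t - r) powr \<alpha>)"
      by (intro set_integral_add(1) int1 int2)
    show "((\<lambda>t. \<phi> t * e t) has_real_derivative D t * e t + \<phi> t / (t - r) powr \<alpha>) (at t)"
      if "r < t" "t < T" for t
    proof -
      have e': "(e has_real_derivative 1 / (t - r) powr \<alpha>) (at t)"
        unfolding e_def using deriv_powr_left[OF alpha(2) that(1)] .
      have "(\<phi> has_real_derivative D t) (at t)" using that r by (intro deriv) auto
      from DERIV_mult[OF this e'] show ?thesis by (simp add: algebra_simps)
    qed
  qed
  then have "\<phi> T * e T = (LINT t:{r<..<T}|lebesgue. D t * e t) + (LINT t:{r<..<T}|lebesgue. \<phi> t / (t - r) powr \<alpha>)"
    using set_integral_add(2)[OF int1 int2] by (simp add: e_def)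
  moreover have "(LINT s:{r<..<T}|lebesgue. H s) = (LINT s:{r<..<T}|lebesgue. \<phi> T / (T - s) powr \<alpha>) - (LINT s:{r<..<T}|lebesgue. ?J s)"
    unfolding H_def by (rule set_integral_diff(2)[OF w J_int])
  moreover have "(LINT s:{r<..<T}|lebesgue. \<phi> T / (T - s) powr \<alpha>) = \<phi> T * e T"
  proof -
    have "(LINT s:{r<..<T}|lebesgue. \<phi> T * (1 / (T - s) powr \<alpha>))
        = \<phi> T * (LINT s:{r<..<T}|lebesgue. 1 / (T - s) powr \<alpha>)"
      by (rule set_integral_mult_right)
    then show ?thesis unfolding set_integral_powr_right[OF alpha(2) r(2)] by (simp add: e_def)
  qed
  ultimately show "(LINT s:{r<..<T}|lebesgue. H s) = (LINT t:{r<..<T}|lebesgue. \<phi> t / (t - r) powr \<alpha>)"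
    using J_eq by simp
qed

text \<open>
  Fubini turns the left side into the integral of \<open>deriv f\<close> against the right Abel
  integral of \<open>\<phi>\<close>; the latter is the integral of \<open>H\<close> over \<open>{s<..<T}\<close>, so a second use of Fubini leaves the
  integral of \<open>H\<close> against \<open>f t - f 0\<close>. The constant \<open>f 0\<close> yields the term with the Abel integral
  of \<open>\<phi>\<close> at 0, and expanding \<open>H\<close> yields the other two.
\<close>

lemma caputo_integration_by_parts:
  assumes alpha: "0 < \<alpha>" "\<alpha> < 1" and T: "0 < T"
    and f: "caputo_smooth_on 0 T f"
    and cont: "continuous_on {0..T} \<phi>" and D: "continuous_on {0..T} D"
    and deriv: "\<And>x. 0 < x \<Longrightarrow> x < T \<Longrightarrow> (\<phi> has_real_derivative D x) (at x)"
  shows "(LINT t:{0<..<T}|lebesgue. \<phi> t * (LINT s:{0<..<t}|lebesgue. deriv f s / (t - s) powr \<alpha>))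
    = - (LINT t:{0<..<T}|lebesgue. f t * (LINT s:{t<..<T}|lebesgue. D s / (s - t) powr \<alpha>))
      + \<phi> T * (LINT t:{0<..<T}|lebesgue. f t / (T - t) powr \<alpha>)
      - f 0 * (LINT s:{0<..<T}|lebesgue. \<phi> s / s powr \<alpha>)"
proof -
  have f_cont: "continuous_on {0..T} f" and f_int: "set_integrable lebesgue {0<..<T} (deriv f)"
    and f_deriv: "\<And>t. 0 < t \<Longrightarrow> t < T \<Longrightarrow> (f has_real_derivative deriv f t) (at t)"
    using f by (auto simp: caputo_smooth_on_def DERIV_deriv_iff_real_differentiable)
  obtain M where M: "M \<ge> 0" "\<And>t. t \<in> {0..T} \<Longrightarrow> \<bar>\<phi> t\<bar> \<le> M"
    using continuous_on_Icc_abs_bound[OF cont] by blast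
  let ?J = "\<lambda>s. LINT t:{s<..<T}|lebesgue. D t / (t - s) powr \<alpha>"
  let ?\<Phi> = "\<lambda>s. LINT t:{s<..<T}|lebesgue. \<phi> t / (t - s) powr \<alpha>"
  define H where "H s = \<phi> T / (T - s) powr \<alpha> - ?J s" for s
  have H: "(LINT s:{r<..<T}|lebesgue. H s) = ?\<Phi> r" and J_int: "set_integrable lebesgue {r<..<T} ?J"
    and H_int: "set_integrable lebesgue {r<..<T} H" if "0 \<le> r" "r \<le> T" for r
    unfolding H_def by (rule abel_integral_by_parts[OF alpha that cont D deriv]; assumption)+
  have T': "0 \<le> T" using T by simp
  have pow0_right: "(LINT t:{s<..<b}|lebesgue. q t / (t - s) powr 0) = (LINT t:{s<..<b}|lebesgue. q t)"
    and pow0_left: "(LINT t:{b<..<s}|lebesgue. q t / (s - t) powr 0) = (LINT t:{b<..<s}|lebesgue. q t)"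
    for q :: "real \<Rightarrow> real" and s b
    by (rule set_lebesgue_integral_cong; auto)+
  have "(LINT t:{0<..<T}|lebesgue. \<phi> t * (LINT s:{0<..<t}|lebesgue. deriv f s / (t - s) powr \<alpha>))
      = (LINT s:{0<..<T}|lebesgue. deriv f s * ?\<Phi> s)"
    by (rule Fubini_triangle(1)[OF f_int continuous_borel_measurable_Ioo[OF cont order_refl]
          abel_integrable[OF alpha(2) _ _ cont M(2)] abel_integral_bound[OF alpha(2) _ _ cont M(2)], symmetric]) auto
  also have "\<dots> = (LINT s:{0<..<T}|lebesgue. deriv f s * (LINT t:{s<..<T}|lebesgue. H t / (t - s) powr 0))"
    by (rule set_lebesgue_integral_cong) (auto simp: pow0_right H simp del: powr_zero_eq_one)
  also have "\<dots> = (LINT t:{0<..<T}|lebesgue. H t * (LINT s:{0<..<t}|lebesgue. deriv f s / (t - s) powr 0))"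
  proof (rule Fubini_triangle(1)[OF f_int])
    show "set_borel_measurable lebesgue {0<..<T} H"
      using H_int[of 0] T by (simp add: set_integrable_def set_borel_measurable_def)
    show "set_integrable lebesgue {s<..<T} (\<lambda>t. H t / (t - s) powr 0)" if "0 < s" "s < T" for s
      using H_int[of s] that by (subst set_integrable_cong[OF refl refl, of _ _ H]) auto
    show "(LINT t:{s<..<T}|lebesgue. \<bar>H t / (t - s) powr 0\<bar>) \<le> (LINT t:{0<..<T}|lebesgue. \<bar>H t\<bar>)"
      if "0 < s" "s < T" for s
    proof -
      have "(LINT t:{s<..<T}|lebesgue. \<bar>H t / (t - s) powr 0\<bar>) = (LINT t:{s<..<T}|lebesgue. \<bar>H t\<bar>)"
        by (rule set_lebesgue_integral_cong) auto
      also have "\<dots> \<le> (LINT t:{0<..<T}|lebesgue. \<bar>H t\<bar>)"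
        unfolding set_lebesgue_integral_def
      proof (rule integral_mono)
        show "integrable lebesgue (\<lambda>t. indicator {s<..<T} t *\<^sub>R \<bar>H t\<bar>)"
          "integrable lebesgue (\<lambda>t. indicator {0<..<T} t *\<^sub>R \<bar>H t\<bar>)"
          using set_integrable_abs[OF H_int[of s]] set_integrable_abs[OF H_int[of 0]] that
          by (simp_all add: set_integrable_def)
      qed (use that in \<open>auto simp: indicator_def\<close>)
      finally show ?thesis .
    qed
  qed
  also have "\<dots> = (LINT t:{0<..<T}|lebesgue. H t * (f t - f 0))"
  proof (rule set_lebesgue_integral_cong)
    show "\<forall>t. t \<in> {0<..<T} \<longrightarrow> H t * (LINT s:{0<..<t}|lebesgue. deriv f s / (t - s) powr 0) = H t * (f t - f 0)"
    proof (intro allI impI)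
      fix t assume t: "t \<in> {0<..<T}"
      have "(LINT s:{0<..<t}|lebesgue. deriv f s) = f t - f 0"
      proof (rule set_integral_FTC)
        show "continuous_on {0..t} f" by (rule continuous_on_subset[OF f_cont]) (use t in auto)
        show "set_integrable lebesgue {0<..<t} (deriv f)"
          by (rule set_integrable_subset[OF f_int]) (use t in auto)
      qed (use t f_deriv in auto)
      then show "H t * (LINT s:{0<..<t}|lebesgue. deriv f s / (t - s) powr 0) = H t * (f t - f 0)"
        by (simp add: pow0_left del: powr_zero_eq_one)
    qed
  qed simp
  also have "\<dots> = (LINT t:{0<..<T}|lebesgue. f t * H t - f 0 * H t)"
    by (rule set_lebesgue_integral_cong) (auto simp: algebra_simps)
  also have "\<dots> = (LINT t:{0<..<T}|lebesgue. f t * H t) - (LINT t:{0<..<T}|lebesgue. f 0 * H t)"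
    using H_int[of 0] T by (intro set_integral_diff(2) set_integrable_continuous_mult f_cont continuous_on_const) auto
  also have "(LINT t:{0<..<T}|lebesgue. f 0 * H t) = f 0 * ?\<Phi> 0"
    using H[of 0] T by simp
  also have "(LINT t:{0<..<T}|lebesgue. f t * H t)
      = (LINT t:{0<..<T}|lebesgue. \<phi> T * (f t / (T - t) powr \<alpha>) - f t * ?J t)"
    by (rule set_lebesgue_integral_cong) (auto simp: H_def algebra_simps)
  also have "\<dots> = (LINT t:{0<..<T}|lebesgue. \<phi> T * (f t / (T - t) powr \<alpha>)) - (LINT t:{0<..<T}|lebesgue. f t * ?J t)"
  proof (rule set_integral_diff(2))
    show "set_integrable lebesgue {0<..<T} (\<lambda>t. \<phi> T * (f t / (T - t) powr \<alpha>))"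
      using set_integrable_continuous_mult[OF f_cont set_integrable_powr_right[OF alpha(2) T']]
      by (intro set_integrable_mult_right) simp
    show "set_integrable lebesgue {0<..<T} (\<lambda>t. f t * ?J t)"
      by (rule set_integrable_continuous_mult[OF f_cont J_int]) (use T in auto)
  qed
  also have "(LINT t:{0<..<T}|lebesgue. \<phi> T * (f t / (T - t) powr \<alpha>))
      = \<phi> T * (LINT t:{0<..<T}|lebesgue. f t / (T - t) powr \<alpha>)"
    by (rule set_integral_mult_right)
  finally show ?thesis by simp
qed

theorem proposition5:
  fixes \<alpha> T f0 :: real
    and F :: "nat \<Rightarrow> nat \<Rightarrow> real"
    and f \<phi> :: "real \<Rightarrow> real"
  assumes "0 < \<alpha>" and "\<alpha> < 1" and "0 < T"
    and initial: "\<And>N. N \<ge> 1 \<Longrightarrow> F N 0 = f0"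
    and L1_conv: "weighted_L1_tendsto 0 T (\<lambda>t. 1) (\<lambda>N. step_interp (T / real N) N (F N)) f"
    and C1: "C1_on_Icc 0 T \<phi>"
    and no_concentration: "\<phi> T \<noteq> 0 \<Longrightarrow>
      weighted_L1_tendsto 0 T (\<lambda>t. 1 / (T - t) powr \<alpha>) (\<lambda>N. step_interp (T / real N) N (F N)) f"
  shows
    "((\<lambda>N. LINT t:{0<..<T}|lebesgue. step_caputo \<alpha> (T / real N) N (F N) t * \<phi> t)
      \<longlonglongrightarrow> - (LINT t:{0<..<T}|lebesgue. f t * right_caputo \<alpha> T \<phi> t)
          + \<phi> T / Gamma (1 - \<alpha>) * (LINT t:{0<..<T}|lebesgue. f t / (T - t) powr \<alpha>)
          - f0 / Gamma (1 - \<alpha>) * (LINT s:{0<..<T}|lebesgue. \<phi> s / s powr \<alpha>))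
     \<and>
     (caputo_smooth_on 0 T f \<and> f 0 = f0 \<longrightarrow>
       (\<lambda>N. LINT t:{0<..<T}|lebesgue. step_caputo \<alpha> (T / real N) N (F N) t * \<phi> t)
        \<longlonglongrightarrow> (LINT t:{0<..<T}|lebesgue. left_caputo \<alpha> f t * \<phi> t))"
proof -
  obtain D where D: "continuous_on {0..T} D"
    and D_deriv: "\<And>t. t \<in> {0..T} \<Longrightarrow> (\<phi> has_real_derivative D t) (at t within {0..T})"
    using C1 by (auto simp: C1_on_Icc_def)
  have cont: "continuous_on {0..T} \<phi>" using D_deriv by (rule DERIV_continuous_on)
  have deriv: "(\<phi> has_real_derivative D t) (at t)" if "0 < t" "t < T" for t
    using D_deriv[of t] that at_within_Icc_at[of 0 t T] by simp
  let ?J = "\<lambda>t. LINT s:{t<..<T}|lebesgue. D s / (s - t) powr \<alpha>"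
  let ?L = "1 / Gamma (1 - \<alpha>) * (\<phi> T * (LINT t:{0<..<T}|lebesgue. f t / (T - t) powr \<alpha>)
          - (LINT t:{0<..<T}|lebesgue. f t * ?J t)
          - f0 * (LINT s:{0<..<T}|lebesgue. \<phi> s / s powr \<alpha>))"
  have lim: "(\<lambda>N. LINT t:{0<..<T}|lebesgue. step_caputo \<alpha> (T / real N) N (F N) t * \<phi> t) \<longlonglongrightarrow> ?L"
    by (rule step_caputo_tendsto[OF assms(1-5) cont D deriv no_concentration])
  have right: "(LINT t:{0<..<T}|lebesgue. f t * right_caputo \<alpha> T \<phi> t)
      = 1 / Gamma (1 - \<alpha>) * (LINT t:{0<..<T}|lebesgue. f t * ?J t)"
  proof -
    have "right_caputo \<alpha> T \<phi> t = 1 / Gamma (1 - \<alpha>) * ?J t" if "0 < t" for t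
    proof -
      have "(LINT s:{t<..<T}|lebesgue. deriv \<phi> s / (s - t) powr \<alpha>) = ?J t"
        by (rule set_lebesgue_integral_cong) (use that deriv in \<open>auto simp: DERIV_imp_deriv\<close>)
      then show ?thesis by (simp only: right_caputo_def)
    qed
    then have "(LINT t:{0<..<T}|lebesgue. f t * right_caputo \<alpha> T \<phi> t)
        = (LINT t:{0<..<T}|lebesgue. 1 / Gamma (1 - \<alpha>) * (f t * ?J t))"
      by (intro set_lebesgue_integral_cong) auto
    also have "\<dots> = 1 / Gamma (1 - \<alpha>) * (LINT t:{0<..<T}|lebesgue. f t * ?J t)"
      by (rule set_integral_mult_right)
    finally show ?thesis .
  qed
  have "?L = (LINT t:{0<..<T}|lebesgue. left_caputo \<alpha> f t * \<phi> t)"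
    if f: "caputo_smooth_on 0 T f" "f 0 = f0"
  proof -
    have "(LINT t:{0<..<T}|lebesgue. left_caputo \<alpha> f t * \<phi> t)
        = (LINT t:{0<..<T}|lebesgue. 1 / Gamma (1 - \<alpha>)
            * (\<phi> t * (LINT s:{0<..<t}|lebesgue. deriv f s / (t - s) powr \<alpha>)))"
      by (simp add: left_caputo_def mult.commute)
    also have "\<dots> = 1 / Gamma (1 - \<alpha>)
        * (LINT t:{0<..<T}|lebesgue. \<phi> t * (LINT s:{0<..<t}|lebesgue. deriv f s / (t - s) powr \<alpha>))"
      by (rule set_integral_mult_right)
    also have "(LINT t:{0<..<T}|lebesgue. \<phi> t * (LINT s:{0<..<t}|lebesgue. deriv f s / (t - s) powr \<alpha>))
        = - (LINT t:{0<..<T}|lebesgue. f t * ?J t)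
          + \<phi> T * (LINT t:{0<..<T}|lebesgue. f t / (T - t) powr \<alpha>)
          - f0 * (LINT s:{0<..<T}|lebesgue. \<phi> s / s powr \<alpha>)"
      using caputo_integration_by_parts[OF assms(1-3) f(1) cont D deriv] f(2) by simp
    also have "1 / Gamma (1 - \<alpha>) * \<dots> = ?L" by (simp only: add.commute diff_conv_add_uminus)
    finally show ?thesis ..
  qed
  then have left: "caputo_smooth_on 0 T f \<and> f 0 = f0 \<Longrightarrow>
      ?L = (LINT t:{0<..<T}|lebesgue. left_caputo \<alpha> f t * \<phi> t)" by blast
  have limit_eq: "?L = - (LINT t:{0<..<T}|lebesgue. f t * right_caputo \<alpha> T \<phi> t)
          + \<phi> T / Gamma (1 - \<alpha>) * (LINT t:{0<..<T}|lebesgue. f t / (T - t) powr \<alpha>)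
          - f0 / Gamma (1 - \<alpha>) * (LINT s:{0<..<T}|lebesgue. \<phi> s / s powr \<alpha>)"
    unfolding right by (simp add: right_diff_distrib)
  show ?thesis
  proof (intro conjI impI)
    show "(\<lambda>N. LINT t:{0<..<T}|lebesgue. step_caputo \<alpha> (T / real N) N (F N) t * \<phi> t)
        \<longlonglongrightarrow> (LINT t:{0<..<T}|lebesgue. left_caputo \<alpha> f t * \<phi> t)"
      if "caputo_smooth_on 0 T f \<and> f 0 = f0"
      using lim unfolding left[OF that] .
  qed (use lim[unfolded limit_eq] in assumption)
qed

end
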